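(* Let $\epsilon_0$ be a positive real number and $w$ a positive integer. Let $\mathcal F$ be a class of finite weighted graphs $(G,\phi)$ with $\phi(e)\ge\epsilon_0$ for every $e\in E(G)$ and such that $G$ has layered tree-width at most $w$. Then the asymptotic dimension of $\mathcal F$ is at most $2$.
   Context: A weighted graph $(G,\phi)$ has $G$ simple and $\phi:E(G)\to\mathbb R^+$; it generates the metric space $(V(G),d_{(G,\phi)})$ with $d_{(G,\phi)}$ the infimum of path lengths (sums of weights). A tree-decomposition $(T,(X_t))$ of $G$: $T$ a tree, bags cover all vertices and edges, $\{t:v\in X_t\}$ connected for each $v$. A layering is an ordered partition $(V_1,V_2,\dots)$ of $V(G)$ into possibly empty sets such that every edge has both ends in some $V_i\cup V_{i+1}$. The layered tree-width is the minimum $w$ such that some tree-decomposition and layering satisfy $|X_t\cap V_i|\le w$ for all $t,i$. For a class of metric spaces and $n\ge0$, $f:\mathbb R^+\to\mathbb R^+$ is a common $n$-dimensional control function if for each member $(X,d)$ and $r>0$ there are collections $\mathcal U_1,\dots,\mathcal U_{n+1}$ of subsets covering $X$ with distinct members of the same $\mathcal U_i$ at distance $>r$ pointwise and each member of diameter $\le f(r)$; the asymptotic dimension is the least $n$ for which such $f$ exists. *)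

theory Defs
  imports Complex_Main "HOL-Library.Extended_Real" "HOL-Library.Disjoint_Sets"
begin

section \<open>Simple graphs, paths, trees\<close>

record 'a sgraph =
  verts :: "'a set"
  edges :: "'a set set"

definition simple_graph :: "'a sgraph \<Rightarrow> bool" where
  "simple_graph G \<longleftrightarrow> (\<forall>e\<in>edges G. e \<subseteq> verts G \<and> card e = 2)"

definition is_path :: "'a sgraph \<Rightarrow> 'a list \<Rightarrow> bool" where
  "is_path G p \<longleftrightarrow> p \<noteq> [] \<and> distinct p \<and> set p \<subseteq> verts G \<and>
     successively (\<lambda>u v. {u, v} \<in> edges G) p"

definition paths_between :: "'a sgraph \<Rightarrow> 'a \<Rightarrow> 'a \<Rightarrow> 'a list set" where
  "paths_between G x y = {p. is_path G p \<and> hd p = x \<and> last p = y}"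

definition connected_graph :: "'a sgraph \<Rightarrow> bool" where
  "connected_graph G \<longleftrightarrow> verts G \<noteq> {} \<and>
     (\<forall>x\<in>verts G. \<forall>y\<in>verts G. paths_between G x y \<noteq> {})"

definition is_cycle :: "'a sgraph \<Rightarrow> 'a list \<Rightarrow> bool" where
  "is_cycle G p \<longleftrightarrow> is_path G p \<and> 3 \<le> length p \<and> {last p, hd p} \<in> edges G"

definition is_tree :: "'a sgraph \<Rightarrow> bool" where
  "is_tree T \<longleftrightarrow> simple_graph T \<and> connected_graph T \<and> (\<nexists>p. is_cycle T p)"

definition induced_subgraph :: "'a sgraph \<Rightarrow> 'a set \<Rightarrow> 'a sgraph" where
  "induced_subgraph G S = \<lparr>verts = S, edges = {e \<in> edges G. e \<subseteq> S}\<rparr>"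

section \<open>Layered tree-width\<close>

definition tree_decomposition ::
    "'a sgraph \<Rightarrow> 't sgraph \<Rightarrow> ('t \<Rightarrow> 'a set) \<Rightarrow> bool" where
  "tree_decomposition G T X \<longleftrightarrow> is_tree T \<and>
     (\<Union>t\<in>verts T. X t) = verts G \<and>
     (\<forall>e\<in>edges G. \<exists>t\<in>verts T. e \<subseteq> X t) \<and>
     (\<forall>v\<in>verts G. connected_graph (induced_subgraph T {t \<in> verts T. v \<in> X t}))"

definition layering :: "'a sgraph \<Rightarrow> (nat \<Rightarrow> 'a set) \<Rightarrow> bool" where
  "layering G L \<longleftrightarrow> disjoint_family L \<and> (\<Union>i. L i) = verts G \<and>
     (\<forall>e\<in>edges G. \<exists>i. e \<subseteq> L i \<union> L (Suc i))"

text \<open>Decomposition trees have nodes in \<^typ>\<open>nat\<close>. For finite graphs this loses nothing: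
  any tree-decomposition can be restricted to a finite subtree whose bags still cover all
  vertices and edges, and its nodes can be renamed. The value is \<open>\<infinity>\<close> if no width is
  attained.\<close>

definition layered_treewidth :: "'a sgraph \<Rightarrow> enat" where
  "layered_treewidth G = Inf {enat w |w. \<exists>(T :: nat sgraph) X L.
     tree_decomposition G T X \<and> layering G L \<and>
     (\<forall>t\<in>verts T. \<forall>i. finite (X t \<inter> L i) \<and> card (X t \<inter> L i) \<le> w)}"

section \<open>Asymptotic dimension\<close>

text \<open>A metric space is a carrier with a distance function. Distances may be infinite, since
  the spaces generated by disconnected graphs are included.\<close>

type_synonym 'a metric_sp = "'a set \<times> ('a \<Rightarrow> 'a \<Rightarrow> ereal)"

definition common_control_function ::
    "'a metric_sp set \<Rightarrow> nat \<Rightarrow> (real \<Rightarrow> real) \<Rightarrow> bool" where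
  "common_control_function \<X> n f \<longleftrightarrow> (\<forall>r>0. f r > 0) \<and>
     (\<forall>(X, d)\<in>\<X>. \<forall>r>0. \<exists>\<U> :: nat \<Rightarrow> 'a set set.
        (\<forall>i\<in>{1..n+1}. \<forall>A\<in>\<U> i. A \<subseteq> X) \<and>
        X = (\<Union>i\<in>{1..n+1}. \<Union>(\<U> i)) \<and>
        (\<forall>i\<in>{1..n+1}. \<forall>A\<in>\<U> i. \<forall>B\<in>\<U> i. A \<noteq> B \<longrightarrow>
           (\<forall>x\<in>A. \<forall>y\<in>B. d x y > ereal r)) \<and>
        (\<forall>i\<in>{1..n+1}. \<forall>A\<in>\<U> i. \<forall>x\<in>A. \<forall>y\<in>A. d x y \<le> ereal (f r)))"

definition asymptotic_dimension :: "'a metric_sp set \<Rightarrow> enat" where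
  "asymptotic_dimension \<X> = Inf {enat n |n. \<exists>f. common_control_function \<X> n f}"

section \<open>Weighted graphs\<close>

type_synonym 'a wgraph = "'a sgraph \<times> ('a set \<Rightarrow> real)"

definition weighted_graph :: "'a wgraph \<Rightarrow> bool" where
  "weighted_graph = (\<lambda>(G, \<phi>). simple_graph G \<and> (\<forall>e\<in>edges G. \<phi> e > 0))"

definition path_length :: "('a set \<Rightarrow> real) \<Rightarrow> 'a list \<Rightarrow> real" where
  "path_length \<phi> p = (\<Sum>i<length p - 1. \<phi> {p ! i, p ! Suc i})"

text \<open>The infimum of the empty set is \<open>\<infinity>\<close>, so vertices in different components are at
  infinite distance.\<close>

definition wdist :: "'a wgraph \<Rightarrow> 'a \<Rightarrow> 'a \<Rightarrow> ereal" where
  "wdist = (\<lambda>(G, \<phi>) x y. INF p\<in>paths_between G x y. ereal (path_length \<phi> p))"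

definition generated_space :: "'a wgraph \<Rightarrow> 'a metric_sp" where
  "generated_space W = (verts (fst W), wdist W)"

end

theory Submission
  imports Defs
begin

text \<open>At scale \<open>r\<close> only the edges of weight at most \<open>r\<close> matter. Since the remaining weights lie in
  \<open>[\<epsilon>\<^sub>0, r]\<close>, weighted distances and hop distances are comparable, and it suffices to colour the
  vertices with three colours such that monochromatic chains of hops of length at most \<open>k\<close> have
  bounded diameter.

  Graphs of bounded tree-width need only two colours, by induction on the width. The bags that meet
  the \<open>3k\<close>-ball around a root bag form a subtree, and removing the ball from them lowers the width,
  so induction colours the rest at a much coarser scale. Each subtree hanging below inherits the
  colours of its attachment set up to distance \<open>k\<close>, is coloured by the first colour up to \<open>2k\<close> and by
  the second up to \<open>3k\<close>. These two shells separate consecutive stages. The first one merges only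
  points of the attachment set that are close at the coarse scale, and those were in the same
  piece already.

  A band of consecutive layers has bounded tree-width. Alternating between bands coloured at a
  fine and at a coarse scale, fine pieces could join coarse pieces of the two neighbouring coarse
  bands. The third colour is used to cut them in between.\<close>

section \<open>Chains of bounded steps\<close>

definition near :: "'a rel \<Rightarrow> nat \<Rightarrow> 'a \<Rightarrow> 'a \<Rightarrow> bool" where
  "near E n x y \<longleftrightarrow> (\<exists>m\<le>n. (x, y) \<in> E ^^ m)"

definition steps :: "'a rel \<Rightarrow> nat \<Rightarrow> 'a set \<Rightarrow> 'a rel" where
  "steps E k S = {(u, v). u \<in> S \<and> v \<in> S \<and> near E k u v}"

text \<open>Hops and final distances are measured in all of \<open>E\<close>, and walks may leave
  \<open>S\<close>. This bounds the weak diameter of the \<open>k\<close>-components of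
  \<open>S\<close>.\<close>

definition bounded_chains :: "'a rel \<Rightarrow> nat \<Rightarrow> nat \<Rightarrow> 'a set \<Rightarrow> bool" where
  "bounded_chains E k D S \<longleftrightarrow> (\<forall>x\<in>S. \<forall>y. (x, y) \<in> (steps E k S)\<^sup>* \<longrightarrow> near E D x y)"

lemma near_refl [simp]: "near E n x x"
  unfolding near_def by (intro exI[of _ 0]) auto

lemma near_edge: "(x, y) \<in> E \<Longrightarrow> 1 \<le> n \<Longrightarrow> near E n x y"
  unfolding near_def by (intro exI[of _ 1]) auto

lemma near_mono: "near E m x y \<Longrightarrow> m \<le> n \<Longrightarrow> near E n x y"
  unfolding near_def by (meson le_trans)

lemma relpow_mono_rel:
  fixes E F :: "'a rel"
  shows "E \<subseteq> F \<Longrightarrow> E ^^ n \<subseteq> F ^^ n"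
  by (induction n) auto

lemma relpow_restrict:
  assumes "(x, y) \<in> E ^^ m" "\<And>z. near E m x z \<Longrightarrow> z \<in> Y"
  shows "(x, y) \<in> (E \<inter> Y \<times> Y) ^^ m"
  using assms
proof (induction m arbitrary: y)
  case (Suc m)
  then obtain z where z: "(x, z) \<in> E ^^ m" "(z, y) \<in> E" by auto
  have "near E (Suc m) x z" "near E (Suc m) x y"
    using z(1) Suc.prems(1) unfolding near_def by (meson le_SucI order_refl)+
  then have "z \<in> Y" "y \<in> Y" using Suc.prems(2) by blast+
  moreover have "(x, z) \<in> (E \<inter> Y \<times> Y) ^^ m"
    using z Suc.prems(2) near_mono[of E m x _ "Suc m"] by (intro Suc.IH) auto
  ultimately show ?case using z by auto
qed auto

lemma near_mono_rel: "near E n x y \<Longrightarrow> E \<subseteq> F \<Longrightarrow> near F n x y"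
  unfolding near_def using relpow_mono_rel by blast

lemma near_trans: "near E m x y \<Longrightarrow> near E n y z \<Longrightarrow> near E (m + n) x z"
  unfolding near_def by (metis add_mono relpow_add relcomp.relcompI)

lemma near_trans_le: "near E m x y \<Longrightarrow> near E n y z \<Longrightarrow> m + n \<le> l \<Longrightarrow> near E l x z"
  using near_trans near_mono by metis

lemma relpow_sym: "sym E \<Longrightarrow> (x, y) \<in> E ^^ m \<Longrightarrow> (y, x) \<in> E ^^ m"
proof (induction m arbitrary: y)
  case (Suc m)
  then obtain z where z: "(x, z) \<in> E ^^ m" "(z, y) \<in> E" by auto
  with Suc have "(z, x) \<in> E ^^ m" "(y, z) \<in> E" by (auto dest: symD)
  then show ?case by (metis relpow_Suc_I2)
qed auto

lemma near_sym: "sym E \<Longrightarrow> near E n x y \<Longrightarrow> near E n y x"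
  unfolding near_def using relpow_sym by metis

lemma near_rtrancl: "near E n x y \<Longrightarrow> (x, y) \<in> E\<^sup>*"
  unfolding near_def using relpow_imp_rtrancl by blast

lemma steps_chain_mono:
  assumes "(x, y) \<in> (steps E k S)\<^sup>*"
    and "\<And>u v. u \<in> S \<Longrightarrow> v \<in> S \<Longrightarrow> near E k u v \<Longrightarrow> (f u, f v) \<in> (steps F l T)\<^sup>*"
  shows "(f x, f y) \<in> (steps F l T)\<^sup>*"
  using assms(1)
proof (induction rule: rtrancl_induct)
  case (step y z)
  then show ?case using assms(2)[of y z] unfolding steps_def by (auto intro: rtrancl_trans)
qed auto

lemma steps_in: "(x, y) \<in> (steps E k S)\<^sup>* \<Longrightarrow> x \<in> S \<Longrightarrow> y \<in> S"
  by (induction rule: rtrancl_induct) (auto simp: steps_def)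

lemma bounded_chainsI:
  "(\<And>x y. x \<in> S \<Longrightarrow> y \<in> S \<Longrightarrow> (x, y) \<in> (steps E k S)\<^sup>* \<Longrightarrow> near E D x y) \<Longrightarrow> bounded_chains E k D S"
  unfolding bounded_chains_def using steps_in by metis

lemma bounded_chainsD:
  "bounded_chains E k D S \<Longrightarrow> x \<in> S \<Longrightarrow> (x, y) \<in> (steps E k S)\<^sup>* \<Longrightarrow> near E D x y"
  unfolding bounded_chains_def by blast

lemma bounded_chains_mono:
  assumes "bounded_chains E k D S" "k' \<le> k" "D \<le> D'" "S' \<subseteq> S"
  shows "bounded_chains E k' D' S'"
proof (rule bounded_chainsI)
  fix x y assume x: "x \<in> S'" "(x, y) \<in> (steps E k' S')\<^sup>*"
  have "steps E k' S' \<subseteq> steps E k S"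
    unfolding steps_def using assms near_mono by fast
  then have "(x, y) \<in> (steps E k S)\<^sup>*" using x rtrancl_mono by blast
  then show "near E D' x y"
    using assms x near_mono by (metis bounded_chainsD subsetD)
qed

text \<open>Moving both ends of a hop by at most \<open>r\<close> stretches it to at most
  \<open>2 * r + k\<close>. Moving the ends of the whole chain back costs another \<open>r\<close>
  each.\<close>

lemma bounded_chains_pull:
  assumes E: "sym E" and b: "bounded_chains E (2 * r + k) D T"
    and p: "\<And>x. x \<in> S \<Longrightarrow> p x \<in> T \<and> near E r x (p x)"
  shows "bounded_chains E k (D + 2 * r) S"
proof (rule bounded_chainsI)
  fix x y assume x: "x \<in> S" "y \<in> S" "(x, y) \<in> (steps E k S)\<^sup>*"
  have "(p x, p y) \<in> (steps E (2 * r + k) T)\<^sup>*"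
  proof (rule steps_chain_mono[OF x(3)])
    fix u v assume u: "u \<in> S" "v \<in> S" "near E k u v"
    have "near E (r + k) (p u) v" using p[OF u(1)] u near_sym[OF E] near_trans by metis
    then have "near E (2 * r + k) (p u) (p v)"
      using p[OF u(2)] by (auto intro: near_trans_le)
    then show "(p u, p v) \<in> (steps E (2 * r + k) T)\<^sup>*"
      using p u by (auto simp: steps_def)
  qed
  then have "near E D (p x) (p y)" using b p x by (metis bounded_chainsD)
  then have "near E (r + D) x (p y)" using p[OF x(1)] near_trans by metis
  then show "near E (D + 2 * r) x y"
    using p[OF x(2)] near_sym[OF E] by (metis near_trans_le add.commute add.assoc mult_2 order_refl)
qed

text \<open>Every hop preserves \<open>h\<close>, so a chain stays in one class.\<close>

lemma bounded_chains_classes: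
  assumes "\<And>q. bounded_chains E k D {x \<in> S. h x = q}"
    and "\<And>x y. x \<in> S \<Longrightarrow> y \<in> S \<Longrightarrow> near E k x y \<Longrightarrow> h x = h y"
  shows "bounded_chains E k D S"
proof (rule bounded_chainsI)
  fix x y assume x: "x \<in> S" "(x, y) \<in> (steps E k S)\<^sup>*"
  have "(x, y) \<in> (steps E k {u \<in> S. h u = h x})\<^sup>* \<and> h y = h x"
    using x(2)
  proof (induction rule: rtrancl_induct)
    case (step y z)
    then have *: "y \<in> S" "z \<in> S" "near E k y z" "h y = h x" by (auto simp: steps_def)
    then have "h z = h x" using assms(2) by metis
    then have "(y, z) \<in> steps E k {u \<in> S. h u = h x}" using * by (auto simp: steps_def)
    then show ?case using step \<open>h z = h x\<close> by auto
  qed auto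
  then show "near E D x y" using x by (intro bounded_chainsD[OF assms(1)[of "h x"]]) auto
qed

text \<open>An excursion into \<open>C\<close> spans at most \<open>M\<close>, so consecutive visits
  to \<open>A\<close> are at most \<open>k + M + k\<close> apart and form a chain of
  \<open>A\<close> at the coarser scale. The excursions before the first and after the last visit
  add \<open>k + M\<close> each.\<close>

lemma bounded_chains_Un:
  assumes E: "sym E" and C: "bounded_chains E k M C" and A: "bounded_chains E (2 * k + M) D A"
  shows "bounded_chains E k (D + 2 * k + 2 * M) (A \<union> C)"
proof (rule bounded_chainsI)
  fix x y assume x: "x \<in> A \<union> C" "(x, y) \<in> (steps E k (A \<union> C))\<^sup>*"
  \<comment> \<open>\<open>?a\<close>: the chain has not left \<open>C\<close>. \<open>?b\<close>:
    \<open>a\<close> starts the chain in \<open>A\<close>, \<open>a'\<close> is its current end, and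
    \<open>y\<close> is \<open>a'\<close> or belongs to the excursion that starts there.\<close>
  let ?a = "\<lambda>y. x \<in> C \<and> (x, y) \<in> (steps E k C)\<^sup>*"
  let ?b = "\<lambda>y. \<exists>a\<in>A. \<exists>a'\<in>A. near E (k + M) x a \<and> (a, a') \<in> (steps E (2 * k + M) A)\<^sup>* \<and>
              (y = a' \<or> (\<exists>c\<in>C. near E k a' c \<and> (c, y) \<in> (steps E k C)\<^sup>*))"
  have "?a y \<or> ?b y" using x(2)
  proof (induction rule: rtrancl_induct)
    case base
    have "?b x" if "x \<in> A" using that by (intro bexI[of _ x]) auto
    then show ?case using x(1) by auto
  next
    case (step y z)
    have z: "z \<in> A \<or> z \<in> C" and yz: "near E k y z" using step(2) by (auto simp: steps_def)
    from step.IH show ?case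
    proof
      assume a: "?a y"
      then have yC: "y \<in> C" using steps_in by metis
      show ?thesis
      proof (cases "z \<in> C")
        case True
        then have "(y, z) \<in> steps E k C" using yC yz by (auto simp: steps_def)
        then show ?thesis using a by auto
      next
        case False
        have "near E M x y" using a C bounded_chainsD by metis
        then have "near E (k + M) x z" using yz by (auto intro: near_trans_le)
        then show ?thesis using False z by blast
      qed
    next
      assume "?b y"
      then obtain a a' where a: "a \<in> A" "a' \<in> A" "near E (k + M) x a" "(a, a') \<in> (steps E (2 * k + M) A)\<^sup>*"
        "y = a' \<or> (\<exists>c\<in>C. near E k a' c \<and> (c, y) \<in> (steps E k C)\<^sup>*)" by blast
      show ?thesis
      proof (cases "z \<in> C")
        case zC: True
        from a(5) have "\<exists>c\<in>C. near E k a' c \<and> (c, z) \<in> (steps E k C)\<^sup>*"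
        proof
          assume "y = a'" then show ?thesis using zC yz by blast
        next
          assume "\<exists>c\<in>C. near E k a' c \<and> (c, y) \<in> (steps E k C)\<^sup>*"
          then obtain c where c: "c \<in> C" "near E k a' c" "(c, y) \<in> (steps E k C)\<^sup>*" by blast
          then have "y \<in> C" using steps_in by metis
          then have "(y, z) \<in> steps E k C" using zC yz by (auto simp: steps_def)
          then show ?thesis using c by (meson rtrancl.rtrancl_into_rtrancl)
        qed
        then show ?thesis using a by blast
      next
        case False
        then have zA: "z \<in> A" using z by blast
        from a(5) have "near E (2 * k + M) a' z"
        proof
          assume "y = a'" then show ?thesis using yz by (auto intro: near_mono)
        next
          assume "\<exists>c\<in>C. near E k a' c \<and> (c, y) \<in> (steps E k C)\<^sup>*"
          then obtain c where c: "c \<in> C" "near E k a' c" "(c, y) \<in> (steps E k C)\<^sup>*" by blast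
          then have "near E M c y" using C bounded_chainsD by metis
          then have "near E (k + M) a' y" using c near_trans by metis
          then show ?thesis using yz by (auto intro: near_trans_le)
        qed
        then have "(a', z) \<in> steps E (2 * k + M) A" using a zA by (auto simp: steps_def)
        then have "(a, z) \<in> (steps E (2 * k + M) A)\<^sup>*" using a by auto
        then show ?thesis using a zA by blast
      qed
    qed
  qed
  then show "near E (D + 2 * k + 2 * M) x y"
  proof
    assume "?a y"
    then have "near E M x y" using C bounded_chainsD by metis
    then show ?thesis by (rule near_mono) auto
  next
    assume "?b y"
    then obtain a a' where a: "a \<in> A" "a' \<in> A" "near E (k + M) x a" "(a, a') \<in> (steps E (2 * k + M) A)\<^sup>*"
        "y = a' \<or> (\<exists>c\<in>C. near E k a' c \<and> (c, y) \<in> (steps E k C)\<^sup>*)" by blast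
    have 1: "near E (k + M + D) x a'" using a A bounded_chainsD near_trans by metis
    have "near E (k + M) a' y"
      using a(5) C by (metis bounded_chainsD near_refl near_trans)
    from near_trans[OF 1 this] show ?thesis by (rule near_mono) auto
  qed
qed

text \<open>Induction on the number of balls. One ball has diameter at most
  \<open>2 * \<rho>\<close> at every scale, so it can be the coarse set of
  \<open>bounded_chains_Un\<close>; the other balls cover the points outside it.\<close>

lemma bounded_chains_balls:
  "\<exists>D. \<forall>(E :: 'a rel) S B. sym E \<longrightarrow> finite B \<longrightarrow> card B \<le> W \<longrightarrow> (\<forall>v\<in>S. \<exists>b\<in>B. near E \<rho> v b) \<longrightarrow>
     bounded_chains E k D S"
proof (induction W)
  case 0
  show ?case by (rule exI[of _ 0]) (auto simp: bounded_chains_def)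
next
  case (Suc W)
  then obtain M where M: "\<And>(E :: 'a rel) S B. sym E \<Longrightarrow> finite B \<Longrightarrow> card B \<le> W \<Longrightarrow>
    (\<forall>v\<in>S. \<exists>b\<in>B. near E \<rho> v b) \<Longrightarrow> bounded_chains E k M S" by metis
  show ?case
  proof (intro exI[of _ "2 * \<rho> + 2 * k + 2 * M"] allI impI)
    fix E :: "'a rel" and S B
    assume E: "sym E" and B: "finite B" "card B \<le> Suc W" and S: "\<forall>v\<in>S. \<exists>b\<in>B. near E \<rho> v b"
    show "bounded_chains E k (2 * \<rho> + 2 * k + 2 * M) S"
    proof (cases "B = {}")
      case True
      then have "S = {}" using S by auto
      then show ?thesis by (simp add: bounded_chains_def)
    next
      case False
      then obtain b where b: "b \<in> B" by auto
      let ?A = "{v \<in> S. near E \<rho> v b}" and ?C = "{v \<in> S. \<not> near E \<rho> v b}"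
      have C: "bounded_chains E k M ?C"
        by (rule M[OF E, of "B - {b}"]) (use B b S in auto)
      have A: "bounded_chains E (2 * k + M) (2 * \<rho>) ?A"
        unfolding bounded_chains_def
      proof (intro ballI allI impI)
        fix x y assume "x \<in> ?A" "(x, y) \<in> (steps E (2 * k + M) ?A)\<^sup>*"
        then have "near E \<rho> x b" "near E \<rho> y b" using steps_in by fast+
        then show "near E (2 * \<rho>) x y" using near_sym[OF E] by (metis near_trans mult_2)
      qed
      have "?A \<union> ?C = S" by auto
      then show ?thesis using bounded_chains_Un[OF E C A] by simp
    qed
  qed
qed

section \<open>Elimination orders\<close>

text \<open>A tree-decomposition is encoded by a perfect elimination order of a chordal supergraph: \<open>bk v\<close>
  are the neighbours of \<open>v\<close> preceding it in the order \<open>rk\<close>, and \<open>insert v (bk v)\<close> is the bag of \<open>v\<close>.\<close>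

locale elimination_order =
  fixes V :: "'a set" and E :: "'a rel" and bk :: "'a \<Rightarrow> 'a set" and rk :: "'a \<Rightarrow> nat"
  assumes finite_V: "finite V" and sym_E: "sym E" and E_V: "E \<subseteq> V \<times> V" and inj_rk: "inj_on rk V"
    and bk_V: "v \<in> V \<Longrightarrow> bk v \<subseteq> V"
    and bk_less: "v \<in> V \<Longrightarrow> u \<in> bk v \<Longrightarrow> rk u < rk v"
    and bk_clique: "v \<in> V \<Longrightarrow> u \<in> bk v \<Longrightarrow> u' \<in> bk v \<Longrightarrow> rk u < rk u' \<Longrightarrow> u \<in> bk u'"
    and E_bk: "(u, v) \<in> E \<Longrightarrow> u = v \<or> u \<in> bk v \<or> v \<in> bk u"
begin

lemma finite_bk: "v \<in> V \<Longrightarrow> finite (bk v)"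
  using bk_V finite_V finite_subset by blast

lemma bk_comparable:
  "v \<in> V \<Longrightarrow> u \<in> bk v \<Longrightarrow> u' \<in> bk v \<Longrightarrow> u = u' \<or> u \<in> bk u' \<or> u' \<in> bk u"
  using bk_clique bk_V inj_rk by (metis inj_onD linorder_neqE_nat subsetD)

definition desc :: "'a \<Rightarrow> 'a set" where
  "desc q = {v. (q, v) \<in> {(u, v). v \<in> V \<and> u \<in> bk v}\<^sup>*}"

lemma desc_refl [simp]: "q \<in> desc q"
  by (simp add: desc_def)

lemma desc_step: "u \<in> desc q \<Longrightarrow> u \<in> bk v \<Longrightarrow> v \<in> V \<Longrightarrow> v \<in> desc q"
  unfolding desc_def by (auto intro: rtrancl_into_rtrancl)

lemma desc_last:
  assumes "v \<in> desc q" "v \<noteq> q"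
  obtains z where "z \<in> bk v" "z \<in> desc q" "v \<in> V"
  using assms unfolding desc_def by (auto elim: rtranclE)

lemma desc_rk: "v \<in> desc q \<Longrightarrow> v = q \<or> rk q < rk v"
  unfolding desc_def mem_Collect_eq
proof (induction rule: rtrancl_induct)
  case (step y z)
  then have "rk y < rk z" using bk_less by auto
  then show ?case using step by auto
qed auto

lemma desc_antisym: "v \<in> desc q \<Longrightarrow> q \<in> desc v \<Longrightarrow> v = q"
  using desc_rk[of v q] desc_rk[of q v] by auto

lemma desc_V: "v \<in> desc q \<Longrightarrow> q \<in> V \<Longrightarrow> v \<in> V"
  by (metis desc_last)

text \<open>\<open>bk q\<close> separates the subtree below \<open>q\<close> from the rest. If
  \<open>z\<close> precedes \<open>x\<close> on the descent from \<open>q\<close>, then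
  \<open>y\<close> and \<open>z\<close> are comparable, and \<open>z\<close> in \<open>bk y\<close>
  would put \<open>y\<close> into the subtree. So \<open>y\<close> is in \<open>bk z\<close>, and
  the argument repeats up to \<open>q\<close>.\<close>

lemma bk_leaves_desc:
  assumes "x \<in> desc q" "q \<in> V" "y \<in> bk x" "y \<notin> desc q"
  shows "y \<in> bk q"
  using assms(1)[unfolded desc_def mem_Collect_eq] assms(3,4)
proof (induction rule: rtrancl_induct)
  case (step z x)
  then have z: "z \<in> desc q" "z \<in> bk x" "x \<in> V" by (auto simp: desc_def)
  then have "y = z \<or> y \<in> bk z \<or> z \<in> bk y" using bk_comparable step.prems by blast
  moreover have "y \<noteq> z" using z step.prems by auto
  moreover have "y \<in> V" using z(3) step.prems bk_V by auto
  then have "z \<notin> bk y" using z desc_step step.prems by blast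
  ultimately show ?case using step by auto
qed auto

lemma edge_leaves_desc:
  assumes "(x, y) \<in> E" "x \<in> desc q" "q \<in> V" "y \<notin> desc q"
  shows "y \<in> bk q"
proof -
  have "y \<in> V" using assms(1) E_V by auto
  then have "x \<notin> bk y" "x \<noteq> y" using assms desc_step by auto
  then show ?thesis using bk_leaves_desc assms E_bk by blast
qed

lemma walk_leaves_desc:
  assumes "(x, y) \<in> E' ^^ m" "E' \<subseteq> E" "q \<in> V" "x \<in> desc q" "y \<notin> desc q"
  shows "\<exists>s\<in>bk q. \<exists>i j. i + j = m \<and> (x, s) \<in> E' ^^ i \<and> (s, y) \<in> E' ^^ j"
  using assms
proof (induction m arbitrary: y)
  case (Suc m)
  then obtain z where z: "(x, z) \<in> E' ^^ m" "(z, y) \<in> E'" by auto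
  show ?case
  proof (cases "z \<in> desc q")
    case True
    then have "y \<in> bk q" using edge_leaves_desc z Suc.prems by blast
    then show ?thesis using Suc.prems(1) by (intro bexI[of _ y] exI[of _ "Suc m"] exI[of _ 0]) auto
  next
    case False
    then obtain s i j where "s \<in> bk q" "i + j = m" "(x, s) \<in> E' ^^ i" "(s, z) \<in> E' ^^ j"
      using Suc z(1) by blast
    then show ?thesis using z(2)
      by (intro bexI[of _ s] exI[of _ i] exI[of _ "Suc j"]) auto
  qed
qed auto

lemma near_leaves_desc:
  assumes "near E n x y" "q \<in> V" "x \<in> desc q" "y \<notin> desc q"
  shows "\<exists>s\<in>bk q. near E n x s \<and> near E n s y"
proof -
  obtain m where m: "m \<le> n" "(x, y) \<in> E ^^ m" using assms by (auto simp: near_def)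
  obtain s i j where "s \<in> bk q" "i + j = m" "(x, s) \<in> E ^^ i" "(s, y) \<in> E ^^ j"
    using walk_leaves_desc[OF m(2) order_refl assms(2-4)] by blast
  then show ?thesis using m(1) unfolding near_def
    by (intro bexI[of _ s] conjI exI[of _ i] exI[of _ j]) auto
qed

text \<open>The parent in the elimination tree; unspecified when \<open>bk v\<close> is
  empty.\<close>

definition par :: "'a \<Rightarrow> 'a" where
  "par v = (SOME u. u \<in> bk v \<and> (\<forall>u'\<in>bk v. rk u' \<le> rk u))"

lemma par:
  assumes "v \<in> V" "bk v \<noteq> {}"
  shows "par v \<in> bk v" "u \<in> bk v \<Longrightarrow> rk u \<le> rk (par v)"
proof -
  have f: "finite (rk ` bk v)" "rk ` bk v \<noteq> {}" using finite_bk[OF assms(1)] assms(2) by auto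
  obtain m where "m \<in> bk v" "rk m = Max (rk ` bk v)" using Max_in[OF f] by auto
  then have "\<exists>u. u \<in> bk v \<and> (\<forall>u'\<in>bk v. rk u' \<le> rk u)"
    using Max_ge[OF f(1)] by (intro exI[of _ m]) auto
  from someI_ex[OF this] show "par v \<in> bk v" "u \<in> bk v \<Longrightarrow> rk u \<le> rk (par v)"
    by (auto simp: par_def)
qed

lemma par_V: "v \<in> V \<Longrightarrow> bk v \<noteq> {} \<Longrightarrow> par v \<in> V"
  using par bk_V by blast

lemma bk_par:
  assumes "v \<in> V" "u \<in> bk v"
  shows "u = par v \<or> u \<in> bk (par v)"
proof -
  have p: "par v \<in> bk v" "rk u \<le> rk (par v)" "u \<in> V" using par(1)[of v] par(2)[of v u] bk_V assms by auto
  then have "par v \<notin> bk u" using bk_less[of u "par v"] by auto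
  then show ?thesis using bk_comparable[OF assms p(1)] by blast
qed

lemma par_desc:
  assumes "x \<in> desc q" "x \<noteq> q" "q \<in> V"
  shows "x \<in> V" "bk x \<noteq> {}" "par x \<in> desc q"
proof -
  obtain z where z: "z \<in> bk x" "z \<in> desc q" "x \<in> V" using desc_last assms by blast
  then show "x \<in> V" "bk x \<noteq> {}" by auto
  then show "par x \<in> desc q" using z bk_par desc_step par_V by metis
qed

text \<open>\<open>H\<close> may contain pairs outside \<open>E\<close>, as long as they are
  comparable. This admits the shortcuts in \<open>core_edges\<close>.\<close>

lemma restrict:
  assumes "U \<subseteq> V" "sym H" "H \<subseteq> U \<times> U" "\<And>u v. (u, v) \<in> H \<Longrightarrow> u = v \<or> u \<in> bk v \<or> v \<in> bk u"
  shows "elimination_order U H (\<lambda>v. bk v \<inter> U) rk"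
proof
  show "finite U" using assms finite_V finite_subset by blast
  show "inj_on rk U" using assms inj_rk inj_on_subset by blast
  show "\<And>u v. (u, v) \<in> H \<Longrightarrow> u = v \<or> u \<in> bk v \<inter> U \<or> v \<in> bk u \<inter> U"
    using assms by blast
  show "\<And>v u. v \<in> U \<Longrightarrow> u \<in> bk v \<inter> U \<Longrightarrow> rk u < rk v"
    using assms(1) bk_less by blast
  show "\<And>v u u'. v \<in> U \<Longrightarrow> u \<in> bk v \<inter> U \<Longrightarrow> u' \<in> bk v \<inter> U \<Longrightarrow> rk u < rk u' \<Longrightarrow> u \<in> bk u' \<inter> U"
    using assms(1) bk_clique by blast
qed (use assms in simp_all)

end

section \<open>Stages of the induction step\<close>

locale elimination_order_scale = elimination_order +
  fixes k :: nat
begin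

definition nbhd :: "'a \<Rightarrow> 'a set" where
  "nbhd q = {v. \<exists>s\<in>insert q (bk q). near E (3 * k) v s}"

lemma in_nbhd: "s \<in> insert q (bk q) \<Longrightarrow> s \<in> nbhd q"
  unfolding nbhd_def by (intro CollectI bexI[of _ s]) auto

text \<open>A stage is identified with its topmost vertex.\<close>

function stage :: "'a \<Rightarrow> 'a" where
  "stage v = (if v \<in> V \<and> bk v \<noteq> {}
     then (if insert v (bk v) \<inter> nbhd (stage (par v)) \<noteq> {} then stage (par v) else v) else v)"
  by auto
termination
  by (relation "measure rk") (auto intro: bk_less par)

declare stage.simps [simp del]

lemma stage_cases:
  obtains "stage v = v" | "v \<in> V" "bk v \<noteq> {}" "stage v = stage (par v)"
    "insert v (bk v) \<inter> nbhd (stage (par v)) \<noteq> {}"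
  using stage.simps[of v] by metis

lemma rk_induct [consumes 1, case_names less]:
  assumes "v \<in> V" and step: "\<And>v. v \<in> V \<Longrightarrow> (\<And>u. u \<in> V \<Longrightarrow> rk u < rk v \<Longrightarrow> P u) \<Longrightarrow> P v"
  shows "P v"
  using assms(1)
proof (induction "rk v" arbitrary: v rule: less_induct)
  case less
  show ?case using less.prems by (rule step) (rule less.hyps)
qed

lemma par_less: "v \<in> V \<Longrightarrow> bk v \<noteq> {} \<Longrightarrow> rk (par v) < rk v"
  using par bk_less by blast

lemma stage_props:
  assumes "v \<in> V"
  shows "stage v \<in> V \<and> v \<in> desc (stage v) \<and> stage (stage v) = stage v"
  using assms
proof (induction v rule: rk_induct)
  case (less v)
  show ?case
  proof (cases v rule: stage_cases)
    case 2
    then show ?thesis using less.IH[of "par v"] par_V par_less desc_step par by metis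
  qed (use less in auto)
qed

lemmas stage_V = stage_props[THEN conjunct1]
  and stage_desc = stage_props[THEN conjunct2, THEN conjunct1]
  and stage_stage = stage_props[THEN conjunct2, THEN conjunct2]

lemma stage_meets: "v \<in> V \<Longrightarrow> insert v (bk v) \<inter> nbhd (stage v) \<noteq> {}"
  by (cases v rule: stage_cases) (use in_nbhd in auto)

text \<open>Going up parents inside the stage, each bag still contains \<open>u\<close> until
  \<open>u\<close> itself is met. The stage root cannot be passed before, since its bag lies inside
  the ball.\<close>

lemma stage_bk:
  assumes "v \<in> V" "u \<in> insert v (bk v)" "u \<notin> nbhd (stage v)"
  shows "stage u = stage v"
  using assms
proof (induction v rule: rk_induct)
  case (less v)
  show ?case
  proof (cases v rule: stage_cases)
    case 1
    then show ?thesis using less in_nbhd by metis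
  next
    case 2
    then have "u = v \<or> u \<in> insert (par v) (bk (par v))" using less bk_par by blast
    then show ?thesis using less 2 par_V par_less by metis
  qed
qed

text \<open>A stage opens only when the bag of its root misses the ball of the parent's stage. Hence
  its attachment set \<open>bk q\<close> lies in the core of the stage above.\<close>

lemma stage_bk_root:
  assumes "q \<in> V" "stage q = q" "s \<in> bk q"
  shows "stage s = stage (par q)" "s \<notin> nbhd (stage (par q))"
proof -
  have p: "par q \<in> V" "rk (par q) < rk q" using assms par_V par_less by blast+
  have "stage (par q) \<noteq> q" using stage_desc[OF p(1)] desc_rk p(2) by fastforce
  then have e: "insert q (bk q) \<inter> nbhd (stage (par q)) = {}"
    using assms stage.simps[of q] by (metis empty_iff)
  then show "s \<notin> nbhd (stage (par q))" using assms by auto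
  then show "stage s = stage (par q)"
    using bk_par assms stage_bk[OF p(1)] by (metis insertCI)
qed

lemma stage_in_desc:
  assumes "q \<in> V" "stage q = q" "x \<in> desc q"
  shows "stage x \<in> desc q"
proof -
  have "x \<in> V" using assms desc_V by blast
  then show ?thesis using assms(3)
  proof (induction x rule: rk_induct)
    case (less x)
    show ?case
    proof (cases x rule: stage_cases)
      case 2
      show ?thesis
      proof (cases "x = q")
        case False
        then have "par x \<in> desc q" using par_desc less assms by blast
        then show ?thesis using less 2 par_V par_less by metis
      qed (use assms in auto)
    qed (use less in auto)
  qed
qed

text \<open>A walk leaving the subtree would meet \<open>bk (stage z)\<close> within distance
  \<open>k\<close> of \<open>z\<close>, which puts \<open>z\<close> into the ball.\<close>

lemma stays_in_desc:
  assumes "z \<in> V" "z \<notin> nbhd (stage z)" "near E k z w"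
  shows "w \<in> desc (stage z)"
proof (rule ccontr)
  assume "w \<notin> desc (stage z)"
  then obtain s where "s \<in> bk (stage z)" "near E k z s"
    using near_leaves_desc[OF assms(3) stage_V[OF assms(1)] stage_desc[OF assms(1)]] by blast
  moreover then have "near E (3 * k) z s" by (auto intro: near_mono)
  ultimately show False using assms(2) unfolding nbhd_def by auto
qed

text \<open>\<open>q'\<close> is the first stage root met after leaving stage \<open>q\<close> on
  the way down to \<open>z\<close>.\<close>

lemma child_root:
  assumes "q \<in> V" "stage q = q" "z \<in> desc q" "stage z \<noteq> q"
  shows "\<exists>q'\<in>V. stage q' = q' \<and> z \<in> desc q' \<and> q' \<in> desc q \<and> q' \<noteq> q \<and> bk q' \<noteq> {} \<and> stage (par q') = q"
proof -
  have "z \<in> V" using assms desc_V by blast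
  then show ?thesis using assms(3,4)
  proof (induction z rule: rk_induct)
    case (less z)
    have "z \<noteq> q" using less assms by auto
    then have z: "bk z \<noteq> {}" "par z \<in> desc q" "par z \<in> V" "rk (par z) < rk z" 
      using par_desc less assms par_V par_less by blast+
    show ?case
    proof (cases "stage (par z) = q")
      case True
      then have "stage z = z" using less stage_cases[of z] by metis
      then show ?thesis using True less z \<open>z \<noteq> q\<close> by (intro bexI[of _ z]) auto
    next
      case False
      then obtain q' where q': "q' \<in> V" "stage q' = q'" "par z \<in> desc q'" "q' \<in> desc q" "q' \<noteq> q" "bk q' \<noteq> {}"
        "stage (par q') = q" using less z by blast
      then have "z \<in> desc q'" using desc_step less z par by blast
      then show ?thesis using q' by blast
    qed
  qed
qed

section \<open>Cores of stages\<close>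

definition core :: "'a \<Rightarrow> 'a set" where
  "core q = {v \<in> V. stage v = q} - nbhd q"

text \<open>Similar to a torso: comparable core vertices at distance at most \<open>K\<close> in
  \<open>E\<close> become adjacent, even if the connecting walk runs outside the core.\<close>

definition core_edges :: "nat \<Rightarrow> 'a \<Rightarrow> 'a rel" where
  "core_edges K q = {(u, v). u \<in> core q \<and> v \<in> core q \<and> (u = v \<or> u \<in> bk v \<or> v \<in> bk u) \<and> near E K u v}"

lemma core_elimination_order:
  "elimination_order (core q) (core_edges K q) (\<lambda>v. bk v \<inter> core q) rk"
proof (rule restrict)
  show "sym (core_edges K q)" using near_sym[OF sym_E] unfolding core_edges_def sym_def by blast
qed (auto simp: core_edges_def core_def)

text \<open>Every bag of the stage meets the ball, and the vertex of the ball is missing from the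
  core.\<close>

lemma core_width:
  assumes "v \<in> core q" "card (insert v (bk v)) \<le> Suc W"
  shows "card (insert v (bk v \<inter> core q)) \<le> W"
proof -
  have v: "v \<in> V" "stage v = q" "v \<notin> nbhd q" using assms by (auto simp: core_def)
  then obtain u where u: "u \<in> bk v" "u \<in> nbhd q" using stage_meets[of v] by auto
  have "insert v (bk v \<inter> core q) \<subset> insert v (bk v)" using u v by (auto simp: core_def)
  then have "card (insert v (bk v \<inter> core q)) < card (insert v (bk v))"
    using finite_bk[OF v(1)] by (intro psubset_card_mono) auto
  then show ?thesis using assms by linarith
qed

text \<open>A walk avoiding the ball leaves the stage only into the subtree of a lower stage root
  \<open>q'\<close>, and it enters and leaves that subtree through \<open>bk q'\<close>. This set is
  a clique, so the detour, of length at most \<open>K\<close>, is replaced by one core edge.\<close>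

lemma core_walk:
  assumes "q \<in> V" "stage q = q" "x \<in> core q" "y \<in> core q" "m \<le> K"
    and "(x, y) \<in> (E \<inter> (- nbhd q) \<times> (- nbhd q)) ^^ m"
  shows "near (core_edges K q) m x y"
  using assms(3-6)
proof (induction m arbitrary: x rule: less_induct)
  case (less m)
  let ?E = "E \<inter> (- nbhd q) \<times> (- nbhd q)"
  note qV = assms(1) and qr = assms(2)
  show ?case
  proof (cases m)
    case (Suc n)
    obtain z where z: "(x, z) \<in> ?E" "(z, y) \<in> ?E ^^ n"
      using less.prems(4) unfolding Suc by (metis relpow_Suc_D2)
    have x: "x \<in> V" "stage x = q" "x \<in> desc q" and y: "y \<in> V" "stage y = q"
      using less.prems stage_desc unfolding core_def by auto
    have zd: "z \<in> desc q" using z edge_leaves_desc x qV in_nbhd by blast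
    \<comment> \<open>The first \<open>i\<close> steps become the core edge from \<open>x\<close> to
      \<open>s\<close>; induction handles the remaining \<open>j\<close>.\<close>
    have hop: "near (core_edges K q) m x y"
      if s: "s \<in> core q" "x = s \<or> x \<in> bk s \<or> s \<in> bk x" and ij: "i + j = m" "0 < i" "(x, s) \<in> ?E ^^ i" "(s, y) \<in> ?E ^^ j"
      for s i j
    proof -
      have "(x, s) \<in> E ^^ i" using ij(3) relpow_mono_rel[of ?E E] by blast
      then have "near E K x s" unfolding near_def using ij less.prems by (intro exI[of _ i]) auto
      then have "(x, s) \<in> core_edges K q" using s less.prems unfolding core_edges_def by auto
      moreover have "near (core_edges K q) j s y" using less ij s by (intro less.IH) auto
      ultimately show ?thesis using ij near_trans_le[OF near_edge[of x s _ 1], of _ j y m] by auto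
    qed
    show ?thesis
    proof (cases "stage z = q")
      case True
      then have "z \<in> core q" using z E_V by (auto simp: core_def)
      then show ?thesis using z E_bk Suc by (intro hop[of z 1 n]) auto
    next
      case False
      then obtain q' where q': "q' \<in> V" "stage q' = q'" "z \<in> desc q'" "q' \<in> desc q" "q' \<noteq> q" "bk q' \<noteq> {}"
        "stage (par q') = q" using child_root[OF qV qr zd] by blast
      \<comment> \<open>A vertex of stage \<open>q\<close> below \<open>q'\<close> would make
        \<open>q\<close> a descendant of \<open>q'\<close>.\<close>
      have nd: "v \<notin> desc q'" if "v \<in> V" "stage v = q" for v
        using stage_in_desc[OF q'(1,2), of v] that q' desc_antisym by metis
      have xb: "x \<in> bk q'"
        using edge_leaves_desc[of z x q'] z q' nd x sym_E by (auto dest: symD)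
      obtain s i j where s: "s \<in> bk q'" "i + j = n" "(z, s) \<in> ?E ^^ i" "(s, y) \<in> ?E ^^ j"
        using walk_leaves_desc[OF z(2) _ q'(1,3) nd[OF y]] by blast
      have "s \<in> core q" using s stage_bk_root[OF q'(1,2) s(1)] q' bk_V by (auto simp: core_def)
      moreover have "x = s \<or> x \<in> bk s \<or> s \<in> bk x" using bk_comparable q'(1) xb s(1) by blast
      moreover have "(x, s) \<in> ?E ^^ Suc i" using z(1) s(3) by (rule relpow_Suc_I2)
      ultimately show ?thesis using s Suc by (intro hop[of s "Suc i" j]) auto
    qed
  qed (use less in \<open>auto intro: near_refl\<close>)
qed

lemma core_near:
  assumes "q \<in> V" "stage q = q" "x \<in> core q" "y \<in> core q" "near E K x y" "\<forall>z\<in>nbhd q. \<not> near E K x z"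
  shows "near (core_edges K q) K x y"
proof -
  obtain m where m: "m \<le> K" "(x, y) \<in> E ^^ m" using assms by (auto simp: near_def)
  have "(x, y) \<in> (E \<inter> (- nbhd q) \<times> (- nbhd q)) ^^ m"
  proof (rule relpow_restrict[OF m(2)])
    fix z assume "near E m x z"
    then have "near E K x z" using m(1) by (rule near_mono)
    then show "z \<in> - nbhd q" using assms(6) by auto
  qed
  from near_mono[OF core_walk[OF assms(1-4) m(1) this] m(1)] show ?thesis .
qed

lemma near_core_edges:
  assumes "near (core_edges K q) n x y"
  shows "near E (n * K) x y"
proof -
  have "near E (m * K) x y" if "(x, y) \<in> core_edges K q ^^ m" for m y
    using that
  proof (induction m arbitrary: y)
    case (Suc m)
    then obtain z where "(x, z) \<in> core_edges K q ^^ m" "(z, y) \<in> core_edges K q" by auto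
    then have "near E (m * K) x z" "near E K z y" using Suc by (auto simp: core_edges_def)
    then show ?case by (auto intro: near_trans_le)
  qed auto
  then show ?thesis using assms near_mono unfolding near_def[of "core_edges K q"]
    by (metis mult_le_mono1)
qed

section \<open>Colours and home stages\<close>

definition upper :: "'a \<Rightarrow> bool" where
  "upper v \<longleftrightarrow> (\<exists>s\<in>bk (stage v). near E (2 * k) v s)"

definition close :: "'a \<Rightarrow> bool" where
  "close v \<longleftrightarrow> (\<exists>s\<in>bk (stage v). near E k v s)"

definition anchor :: "'a \<Rightarrow> 'a" where
  "anchor v = (SOME s. s \<in> bk (stage v) \<and> near E k v s)"

text \<open>The stage whose pieces \<open>v\<close> extends: the inherited part and the
  \<open>True\<close> shell grow out of the stage above.\<close>

definition home :: "'a \<Rightarrow> 'a" where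
  "home v = (if upper v then stage (par (stage v)) else stage v)"

text \<open>\<open>True\<close> is the first colour. Anchors lie in the core of the stage above,
  where \<open>colour c\<close> agrees with \<open>c\<close>, so \<open>c (anchor v)\<close> is the
  final colour of the anchor.\<close>

definition colour :: "('a \<Rightarrow> bool) \<Rightarrow> 'a \<Rightarrow> bool" where
  "colour c v = (if close v then c (anchor v) else if upper v then True
     else if v \<in> nbhd (stage v) then False else c v)"

lemma close_upper: "close v \<Longrightarrow> upper v"
  unfolding close_def upper_def by (metis near_mono le_add1 mult_2)

lemma anchor: "close v \<Longrightarrow> anchor v \<in> bk (stage v) \<and> near E k v (anchor v)"
  unfolding close_def anchor_def by (rule someI_ex) auto

lemma upper_core:
  assumes "v \<in> V" "s \<in> bk (stage v)"
  shows "s \<in> core (stage (par (stage v)))"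
  using stage_bk_root[OF stage_V stage_stage assms(2)] bk_V[OF stage_V] assms
  by (auto simp: core_def)

text \<open>The hop leaves the subtree of \<open>stage y\<close> through a vertex \<open>t\<close>
  of its attachment set, so \<open>home y\<close> is the stage of \<open>t\<close>. Either
  \<open>x\<close> lies in that stage, or the way from \<open>t\<close> to \<open>x\<close> enters
  the subtree of \<open>stage x\<close> through a vertex \<open>s\<close>, and the stages of
  \<open>s\<close> and \<open>t\<close> agree.\<close>

lemma home_eq_aux:
  assumes x: "x \<in> V" and y: "y \<in> V" and n: "near E k x y" and d: "stage x \<notin> desc (stage y)"
  shows "home x = home y"
proof -
  let ?q = "stage x" and ?r = "stage y"
  note qV = stage_V[OF x] and rV = stage_V[OF y] and qr = stage_stage[OF x] and rr = stage_stage[OF y]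
  have "x \<notin> desc ?r" using stage_in_desc[OF rV rr] d by blast
  then obtain t where t: "t \<in> bk ?r" "near E k y t" "near E k t x"
    using near_leaves_desc[OF near_sym[OF sym_E n] rV stage_desc[OF y]] by blast
  let ?r' = "stage (par ?r)"
  have "close y" using t by (auto simp: close_def)
  then have hy: "home y = ?r'" using close_upper by (auto simp: home_def)
  have t': "t \<in> V" "stage t = ?r'" "t \<notin> nbhd ?r'" using upper_core[OF y t(1)] by (auto simp: core_def)
  then have "x \<in> desc ?r'" using stays_in_desc[of t x] t by auto
  moreover have r'V: "?r' \<in> V" "stage ?r' = ?r'" using stage_V stage_stage t' by metis+
  ultimately have qd: "?q \<in> desc ?r'" using stage_in_desc by blast
  show ?thesis
  proof (cases "?q = ?r'")
    case True
    \<comment> \<open>\<open>t\<close> lies outside the ball of this stage, so \<open>x\<close>,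
      being within \<open>k\<close> of \<open>t\<close>, is farther than \<open>2 * k\<close> from
      the attachment set.\<close>
    have "\<not> upper x"
    proof
      assume "upper x"
      then obtain s where s: "s \<in> bk ?q" "near E (2 * k) x s" by (auto simp: upper_def)
      have "near E (3 * k) t s" using t s by (auto intro: near_trans_le)
      then have "t \<in> nbhd ?q" using s by (auto simp: nbhd_def)
      then show False using True t' by auto
    qed
    then show ?thesis using True hy by (auto simp: home_def)
  next
    case False
    then have "?r' \<notin> desc ?q" using qd desc_antisym by blast
    then have "t \<notin> desc ?q" using stage_in_desc[OF qV qr] t' by metis
    then obtain s where s: "s \<in> bk ?q" "near E k x s" "near E k s t"
      using near_leaves_desc[OF near_sym[OF sym_E t(3)] qV stage_desc[OF x]] by blast
    let ?q' = "stage (par ?q)"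
    have "close x" using s by (auto simp: close_def)
    then have hx: "home x = ?q'" using close_upper by (auto simp: home_def)
    have s': "s \<in> V" "stage s = ?q'" "s \<notin> nbhd ?q'" using upper_core[OF x s(1)] by (auto simp: core_def)
    \<comment> \<open>Both \<open>s\<close> and \<open>t\<close> lie outside the balls of their
      stages, so the walk between them stays in both subtrees, and each stage root is a descendant
      of the other.\<close>
    have "t \<in> desc ?q'" using stays_in_desc[of s t] s s' by auto
    moreover have "s \<in> desc ?r'" using stays_in_desc[of t s] near_sym[OF sym_E s(3)] t' by auto
    moreover have "?q' \<in> V" "stage ?q' = ?q'" using stage_V stage_stage s' by metis+
    ultimately have "?r' \<in> desc ?q'" "?q' \<in> desc ?r'"
      using stage_in_desc[of ?q' t] stage_in_desc[of ?r' s] r'V s' t' by auto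
    then show ?thesis using hx hy desc_antisym by metis
  qed
qed

text \<open>A hop across distance \<open>2 * k\<close> from the attachment set joins the two shells:
  \<open>y\<close> is farther than \<open>2 * k\<close>, so \<open>x\<close> is farther than
  \<open>k\<close> and coloured \<open>True\<close>, while \<open>y\<close> is within
  \<open>3 * k\<close> and coloured \<open>False\<close>.\<close>

lemma home_eq_same_stage:
  assumes "near E k x y" "stage x = stage y" "colour c x = colour c y" "upper x"
  shows "upper y"
proof (rule ccontr)
  assume y: "\<not> upper y"
  obtain s where s: "s \<in> bk (stage y)" "near E (2 * k) x s" using assms by (auto simp: upper_def)
  have "\<not> near E k x u" if "u \<in> bk (stage y)" for u
    using near_trans_le[OF near_sym[OF sym_E assms(1)], of k u "2 * k"] that y by (auto simp: upper_def)
  then have "\<not> close x" using assms by (auto simp: close_def)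
  then have "colour c x" using assms by (auto simp: colour_def)
  moreover have "near E (3 * k) y s"
    using near_trans_le[OF near_sym[OF sym_E assms(1)] s(2)] by auto
  then have "y \<in> nbhd (stage y)" using s by (auto simp: nbhd_def)
  then have "\<not> colour c y" using y close_upper by (auto simp: colour_def)
  ultimately show False using assms by auto
qed

lemma home_eq:
  assumes "x \<in> V" "y \<in> V" "near E k x y" "colour c x = colour c y"
  shows "home x = home y"
proof (cases "stage x = stage y")
  case True
  then have "upper x = upper y"
    using home_eq_same_stage[of x y c] home_eq_same_stage[of y x c] near_sym[OF sym_E] assms by metis
  then show ?thesis using True by (auto simp: home_def)
next
  case False
  then have "stage x \<notin> desc (stage y) \<or> stage y \<notin> desc (stage x)" using desc_antisym by blast
  then show ?thesis using home_eq_aux[of x y] home_eq_aux[of y x] near_sym[OF sym_E] assms by metis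
qed

text \<open>Vertices within \<open>K\<close> of the ball may hop through it, but they lie in few
  balls of radius \<open>K + 3 * k\<close>. Between the other vertices hops are walks in the core
  graph, each of whose edges has length at most \<open>K\<close> in \<open>E\<close>; hence
  \<open>F * K\<close>.\<close>

lemma core_bounded_chains:
  assumes F: "bounded_chains (core_edges K q) K F {v \<in> core q. c v = \<gamma>}"
    and balls: "\<And>S B. finite B \<Longrightarrow> card B \<le> W \<Longrightarrow> (\<forall>v\<in>S. \<exists>b\<in>B. near E (K + 3 * k) v b) \<Longrightarrow>
      bounded_chains E (2 * K + F * K) D S"
    and width: "\<And>v. v \<in> V \<Longrightarrow> card (insert v (bk v)) \<le> W"
  shows "bounded_chains E K (D + 2 * K + 2 * (F * K)) {v \<in> core q. c v = \<gamma>}"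
proof (cases "core q = {}")
  case True
  then show ?thesis by (simp add: bounded_chains_def)
next
  case False
  then have q: "q \<in> V" "stage q = q" using stage_V stage_stage by (auto simp: core_def)
  let ?S = "{v \<in> core q. c v = \<gamma>}"
  let ?A = "{v \<in> ?S. \<exists>z\<in>nbhd q. near E K v z}" and ?C = "{v \<in> ?S. \<not> (\<exists>z\<in>nbhd q. near E K v z)}"
  have "bounded_chains E (2 * K + F * K) D ?A"
  proof (rule balls[of "insert q (bk q)"])
    show "\<forall>v\<in>?A. \<exists>b\<in>insert q (bk q). near E (K + 3 * k) v b"
      using near_trans[of E K _ _ "3 * k"] by (fastforce simp: nbhd_def)
  qed (use finite_bk q width in auto)
  moreover have "bounded_chains E K (F * K) ?C"
  proof (rule bounded_chainsI)
    fix x y assume xy: "x \<in> ?C" "y \<in> ?C" "(x, y) \<in> (steps E K ?C)\<^sup>*"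
    have "(id x, id y) \<in> (steps (core_edges K q) K ?S)\<^sup>*"
      using xy(3)
    proof (rule steps_chain_mono)
      fix u v assume uv: "u \<in> ?C" "v \<in> ?C" "near E K u v"
      then have "near (core_edges K q) K u v" using core_near[OF q, of u v K] by auto
      then show "(id u, id v) \<in> (steps (core_edges K q) K ?S)\<^sup>*"
        using uv by (intro r_into_rtrancl) (simp add: steps_def)
    qed
    then have "near (core_edges K q) F x y" using bounded_chainsD[OF F, of x y] xy by auto
    then show "near E (F * K) x y" by (rule near_core_edges)
  qed
  moreover have "?A \<union> ?C = ?S" by auto
  ultimately show ?thesis using bounded_chains_Un[OF sym_E, of K "F * K" ?C D ?A] by metis
qed

lemma close_if_leaves:
  assumes "y \<in> V" "near E k x y" "x \<in> V" "stage x \<notin> desc (stage y)"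
  shows "close y"
proof -
  have "x \<notin> desc (stage y)" using stage_in_desc stage_V stage_stage assms by blast
  then show ?thesis
    using near_leaves_desc[OF near_sym[OF sym_E assms(2)] stage_V stage_desc] assms
    by (auto simp: close_def)
qed

text \<open>A hop between two different stages leaves one of their subtrees and makes an end
  \<open>close\<close>. Inside one stage these vertices lie in balls around the attachment
  set.\<close>

lemma upper_bounded_chains:
  assumes balls: "\<And>S B. finite B \<Longrightarrow> card B \<le> W \<Longrightarrow> (\<forall>v\<in>S. \<exists>b\<in>B. near E (2 * k) v b) \<Longrightarrow>
      bounded_chains E k M S"
    and width: "\<And>v. v \<in> V \<Longrightarrow> card (insert v (bk v)) \<le> W"
  shows "bounded_chains E k M {v \<in> V. upper v \<and> \<not> close v}"
proof (rule bounded_chains_classes[where h = stage])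
  fix q
  show "bounded_chains E k M {x \<in> {v \<in> V. upper v \<and> \<not> close v}. stage x = q}" (is "bounded_chains _ _ _ ?S")
  proof (cases "?S = {}")
    case True
    then show ?thesis by (simp only: bounded_chains_def) simp
  next
    case False
    then have q: "q \<in> V" using stage_V by auto
    have "card (bk q) \<le> card (insert q (bk q))" using finite_bk[OF q] by (intro card_mono) auto
    then have "card (bk q) \<le> W" using width[OF q] by linarith
    then show ?thesis using finite_bk[OF q] by (intro balls[of "bk q"]) (auto simp: upper_def)
  qed
next
  fix x y assume "x \<in> {v \<in> V. upper v \<and> \<not> close v}" "y \<in> {v \<in> V. upper v \<and> \<not> close v}" "near E k x y"
  then show "stage x = stage y"
    using close_if_leaves[of x y] close_if_leaves[of y x] near_sym[OF sym_E] desc_antisym by blast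
qed

text \<open>\<open>?T\<close> joins the core with the vertices inheriting from it; pulling the
  latter to their anchors raises the scale from \<open>2 * k + M\<close> to
  \<open>4 * k + M\<close>. For the first colour the other vertices are shells of lower stages,
  bounded at the fine scale. For the second they form the shell around the root bag of
  \<open>q\<close>.\<close>

lemma home_bounded_chains:
  assumes core: "\<And>q. bounded_chains E (4 * k + M) D {v \<in> core q. c v = \<gamma>}"
    and M: "\<And>S B. finite B \<Longrightarrow> card B \<le> W \<Longrightarrow> (\<forall>v\<in>S. \<exists>b\<in>B. near E (2 * k) v b) \<Longrightarrow>
      bounded_chains E k M S"
    and D': "\<And>S B. finite B \<Longrightarrow> card B \<le> W \<Longrightarrow> (\<forall>v\<in>S. \<exists>b\<in>B. near E (3 * k) v b) \<Longrightarrow>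
      bounded_chains E (2 * k + (D + 2 * k)) D' S"
    and width: "\<And>v. v \<in> V \<Longrightarrow> card (insert v (bk v)) \<le> W"
  shows "bounded_chains E k (D + D' + 8 * k + 2 * M + 2 * D) {v \<in> V. colour c v = \<gamma> \<and> home v = q}" (is "bounded_chains _ _ _ ?S")
proof -
  let ?T = "{v \<in> ?S. close v \<or> \<not> upper v \<and> v \<notin> nbhd q}"
  have T: "bounded_chains E (2 * k + M) (D + 2 * k) ?T"
  proof (rule bounded_chains_pull[OF sym_E, where p = "\<lambda>v. if close v then anchor v else v"])
    show "bounded_chains E (2 * k + (2 * k + M)) D {v \<in> core q. c v = \<gamma>}"
      using core[of q] by (rule bounded_chains_mono) auto
  next
    fix x assume x: "x \<in> ?T"
    show "(if close x then anchor x else x) \<in> {v \<in> core q. c v = \<gamma>} \<and> near E k x (if close x then anchor x else x)"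
    proof (cases "close x")
      case True
      then have "anchor x \<in> core q" using upper_core[of x "anchor x"] anchor x close_upper by (auto simp: home_def)
      then show ?thesis using True anchor x by (auto simp: colour_def)
    next
      case False
      then show ?thesis using x by (auto simp: colour_def home_def core_def)
    qed
  qed
  show ?thesis
  proof (cases \<gamma>)
    case True
    let ?C = "{v \<in> ?S. upper v \<and> \<not> close v}"
    have C: "bounded_chains E k M ?C"
      by (rule bounded_chains_mono[OF upper_bounded_chains[OF M width]]) auto
    have "?T \<union> ?C = ?S" using True by (auto simp: colour_def home_def)
    then have "bounded_chains E k (D + 2 * k + 2 * k + 2 * M) ?S"
      using bounded_chains_Un[OF sym_E C T] by metis
    then show ?thesis by (rule bounded_chains_mono) auto
  next
    case False
    \<comment> \<open>Here the shell is the coarse set of the union and \<open>?T\<close> the fine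
      one.\<close>
    let ?A = "{v \<in> ?S. \<not> upper v \<and> v \<in> nbhd q}"
    have A: "bounded_chains E (2 * k + (D + 2 * k)) D' ?A"
    proof (cases "?A = {}")
      case True
      then show ?thesis by (simp only: bounded_chains_def) simp
    next
      case False
      then have q: "q \<in> V" using stage_V by (auto simp: home_def)
      show ?thesis by (rule D'[of "insert q (bk q)"]) (use finite_bk q width in \<open>auto simp: nbhd_def\<close>)
    qed
    have "?A \<union> ?T = ?S" using False by (auto simp: colour_def home_def)
    moreover have "bounded_chains E k (D + 2 * k) ?T" by (rule bounded_chains_mono[OF T]) auto
    ultimately have "bounded_chains E k (D' + 2 * k + 2 * (D + 2 * k)) ?S"
      using bounded_chains_Un[OF sym_E _ A, of ?T] by metis
    then show ?thesis by (rule bounded_chains_mono) auto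
  qed
qed

end

text \<open>\<open>W\<close> bounds bag sizes, so 0 means no vertices. The induction keeps
  \<open>k\<close> arbitrary because cores are coloured at the larger scale
  \<open>K\<close>.\<close>

theorem elimination_order_colouring:
  "\<exists>F. \<forall>(V :: 'a set) E bk rk. elimination_order V E bk rk \<longrightarrow> (\<forall>v\<in>V. card (insert v (bk v)) \<le> W) \<longrightarrow>
     (\<exists>c :: 'a \<Rightarrow> bool. \<forall>\<gamma>. bounded_chains E k F {v \<in> V. c v = \<gamma>})"
proof (induction W arbitrary: k)
  case 0
  show ?case
  proof (intro exI[of _ 0] allI impI)
    fix V :: "'a set" and E bk and rk :: "'a \<Rightarrow> nat"
    assume e: "elimination_order V E bk rk" and w: "\<forall>v\<in>V. card (insert v (bk v)) \<le> 0"
    have "V = {}" using w elimination_order.finite_bk[OF e] by auto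
    then show "\<exists>c :: 'a \<Rightarrow> bool. \<forall>\<gamma>. bounded_chains E k 0 {v \<in> V. c v = \<gamma>}"
      by (auto simp: bounded_chains_def)
  qed
next
  case (Suc W)
  obtain M where M: "\<And>(E :: 'a rel) S B. sym E \<Longrightarrow> finite B \<Longrightarrow> card B \<le> Suc W \<Longrightarrow>
      (\<forall>v\<in>S. \<exists>b\<in>B. near E (2 * k) v b) \<Longrightarrow> bounded_chains E k M S"
    using bounded_chains_balls[of "Suc W" "2 * k" k] by metis
  \<comment> \<open>The order of choices matters: \<open>M\<close> depends on \<open>k\<close>, then
    \<open>F\<close> on \<open>K\<close>, and only then \<open>D1\<close>, \<open>D\<close> and
    \<open>D'\<close> are chosen.\<close>
  define K where "K = 4 * k + M"
  obtain F where F: "\<And>(V :: 'a set) E bk rk. elimination_order V E bk rk \<Longrightarrow> (\<forall>v\<in>V. card (insert v (bk v)) \<le> W) \<Longrightarrow>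
     (\<exists>c :: 'a \<Rightarrow> bool. \<forall>\<gamma>. bounded_chains E K F {v \<in> V. c v = \<gamma>})"
    using Suc[of K] by metis
  obtain D1 where D1: "\<And>(E :: 'a rel) S B. sym E \<Longrightarrow> finite B \<Longrightarrow> card B \<le> Suc W \<Longrightarrow>
      (\<forall>v\<in>S. \<exists>b\<in>B. near E (K + 3 * k) v b) \<Longrightarrow> bounded_chains E (2 * K + F * K) D1 S"
    using bounded_chains_balls[of "Suc W" "K + 3 * k" "2 * K + F * K"] by metis
  define D where "D = D1 + 2 * K + 2 * (F * K)"
  obtain D' where D': "\<And>(E :: 'a rel) S B. sym E \<Longrightarrow> finite B \<Longrightarrow> card B \<le> Suc W \<Longrightarrow>
      (\<forall>v\<in>S. \<exists>b\<in>B. near E (3 * k) v b) \<Longrightarrow> bounded_chains E (2 * k + (D + 2 * k)) D' S"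
    using bounded_chains_balls[of "Suc W" "3 * k" "2 * k + (D + 2 * k)"] by metis
  show ?case
  proof (intro exI[of _ "D + D' + 8 * k + 2 * M + 2 * D"] allI impI)
    fix V :: "'a set" and E bk and rk :: "'a \<Rightarrow> nat"
    assume e: "elimination_order V E bk rk" and w: "\<forall>v\<in>V. card (insert v (bk v)) \<le> Suc W"
    interpret elimination_order_scale V E bk rk k
      using e by (simp add: elimination_order_scale_def)
    have "\<exists>c :: 'a \<Rightarrow> bool. \<forall>\<gamma>. bounded_chains (core_edges K q) K F {v \<in> core q. c v = \<gamma>}" for q
    proof (rule F[OF core_elimination_order])
      show "\<forall>v\<in>core q. card (insert v (bk v \<inter> core q)) \<le> W"
        using core_width w by (auto simp: core_def)
    qed
    then have "\<forall>q. \<exists>c :: 'a \<Rightarrow> bool. \<forall>\<gamma>. bounded_chains (core_edges K q) K F {v \<in> core q. c v = \<gamma>}" ..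
    from choice[OF this] obtain cc :: "'a \<Rightarrow> 'a \<Rightarrow> bool"
      where cc: "\<And>q \<gamma>. bounded_chains (core_edges K q) K F {v \<in> core q. cc q v = \<gamma>}" by blast
    \<comment> \<open>Cores of different stages are disjoint, so their colourings combine.\<close>
    define c where "c v = cc (stage v) v" for v
    have c: "{v \<in> core q. cc q v = \<gamma>} = {v \<in> core q. c v = \<gamma>}" for q \<gamma>
      by (auto simp: c_def core_def)
    have core: "bounded_chains E (4 * k + M) D {v \<in> core q. c v = \<gamma>}" for q \<gamma>
      unfolding D_def K_def[symmetric]
      by (rule core_bounded_chains[OF cc[of q \<gamma>, unfolded c] D1[OF sym_E]]) (use w in auto)
    show "\<exists>c :: 'a \<Rightarrow> bool. \<forall>\<gamma>. bounded_chains E k (D + D' + 8 * k + 2 * M + 2 * D) {v \<in> V. c v = \<gamma>}"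
    proof (intro exI[of _ "colour c"] allI)
      fix \<gamma>
      show "bounded_chains E k (D + D' + 8 * k + 2 * M + 2 * D) {v \<in> V. colour c v = \<gamma>}"
      proof (rule bounded_chains_classes[where h = home])
        fix q
        have "{x \<in> {v \<in> V. colour c v = \<gamma>}. home x = q} = {v \<in> V. colour c v = \<gamma> \<and> home v = q}" by auto
        then show "bounded_chains E k (D + D' + 8 * k + 2 * M + 2 * D) {x \<in> {v \<in> V. colour c v = \<gamma>}. home x = q}"
          using home_bounded_chains[OF core[where \<gamma> = \<gamma>] M[OF sym_E] D'[OF sym_E]] w by simp
      qed (use home_eq in auto)
    qed
  qed
qed

section \<open>Layered elimination orders\<close>

locale layered_order = elimination_order +
  fixes lay :: "'a \<Rightarrow> nat" and w :: nat
  assumes E_lay: "(u, v) \<in> E \<Longrightarrow> lay u \<le> Suc (lay v)"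
    and width_lay: "v \<in> V \<Longrightarrow> card (insert v (bk v) \<inter> {u. lay u = i}) \<le> w"
begin

lemma near_lay:
  assumes "near E n x y"
  shows "lay x \<le> lay y + n" "lay y \<le> lay x + n"
proof -
  have "lay x \<le> lay y + m \<and> lay y \<le> lay x + m" if "(x, y) \<in> E ^^ m" for m y
    using that
  proof (induction m arbitrary: y)
    case (Suc m)
    then obtain z where z: "(x, z) \<in> E ^^ m" "(z, y) \<in> E" by auto
    then have "lay z \<le> Suc (lay y)" "lay y \<le> Suc (lay z)" using E_lay symD[OF sym_E] by blast+
    then show ?case using Suc.IH[OF z(1)] by auto
  qed auto
  then show "lay x \<le> lay y + n" "lay y \<le> lay x + n"
    using assms unfolding near_def by fastforce+
qed

lemma near_V: "near E n x y \<Longrightarrow> x \<in> V \<Longrightarrow> y \<in> V"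
  using E_V near_rtrancl[of E n x y] by (auto elim: rtranclE)

end

text \<open>Walks of length at most \<open>k\<close> from the band stay in the band widened by
  \<open>k\<close> layers on both sides. Each of these at most \<open>n + 2 * k\<close> layers
  contributes at most \<open>w\<close> to a bag.\<close>

lemma band_colouring:
  "\<exists>F. \<forall>(V :: 'a set) E bk rk lay. layered_order V E bk rk lay w \<longrightarrow>
     (\<forall>a. \<exists>c :: 'a \<Rightarrow> bool. \<forall>\<gamma>. bounded_chains E k F {v \<in> V. a \<le> lay v \<and> lay v < a + n \<and> c v = \<gamma>})"
proof -
  obtain F where F: "\<forall>(V :: 'a set) E bk rk. elimination_order V E bk rk \<longrightarrow>
     (\<forall>v\<in>V. card (insert v (bk v)) \<le> (n + 2 * k) * w) \<longrightarrow>
     (\<exists>c :: 'a \<Rightarrow> bool. \<forall>\<gamma>. bounded_chains E k F {v \<in> V. c v = \<gamma>})"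
    using elimination_order_colouring[where W = "(n + 2 * k) * w" and k = k] ..
  show ?thesis
  proof (intro exI[of _ F] allI impI)
    fix V :: "'a set" and E bk rk lay a
    assume "layered_order V E bk rk lay w"
    then interpret layered_order V E bk rk lay w .
    define U where "U = {v \<in> V. a \<le> lay v + k \<and> lay v < a + n + k}"
    define H where "H = E \<inter> U \<times> U"
    have e: "elimination_order U H (\<lambda>v. bk v \<inter> U) rk"
      by (rule restrict) (use sym_E E_bk in \<open>auto simp: U_def H_def sym_def\<close>)
    have "card (insert v (bk v \<inter> U)) \<le> (n + 2 * k) * w" if v: "v \<in> U" for v
    proof -
      let ?I = "{a - k..<a + n + k}"
      have vV: "v \<in> V" using v by (auto simp: U_def)
      have "insert v (bk v \<inter> U) \<subseteq> (\<Union>i\<in>?I. insert v (bk v) \<inter> {u. lay u = i})"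
        using v by (auto simp: U_def)
      then have "card (insert v (bk v \<inter> U)) \<le> card (\<Union>i\<in>?I. insert v (bk v) \<inter> {u. lay u = i})"
        using finite_bk[OF vV] by (intro card_mono) auto
      also have "\<dots> \<le> (\<Sum>i\<in>?I. card (insert v (bk v) \<inter> {u. lay u = i}))"
        by (rule card_UN_le) auto
      also have "\<dots> \<le> (\<Sum>i\<in>?I. w)" by (rule sum_mono) (rule width_lay[OF vV])
      also have "\<dots> \<le> (n + 2 * k) * w" by (auto intro!: mult_right_mono)
      finally show ?thesis .
    qed
    then obtain c :: "'a \<Rightarrow> bool" where c: "\<And>\<gamma>. bounded_chains H k F {v \<in> U. c v = \<gamma>}"
      using F[rule_format, OF e] by blast
    show "\<exists>c :: 'a \<Rightarrow> bool. \<forall>\<gamma>. bounded_chains E k F {v \<in> V. a \<le> lay v \<and> lay v < a + n \<and> c v = \<gamma>}"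
    proof (intro exI[of _ c] allI bounded_chainsI)
      fix \<gamma> x y
      let ?S = "{v \<in> V. a \<le> lay v \<and> lay v < a + n \<and> c v = \<gamma>}"
      assume xy: "x \<in> ?S" "y \<in> ?S" "(x, y) \<in> (steps E k ?S)\<^sup>*"
      have "(id x, id y) \<in> (steps H k {v \<in> U. c v = \<gamma>})\<^sup>*"
        using xy(3)
      proof (rule steps_chain_mono)
        fix u v assume uv: "u \<in> ?S" "v \<in> ?S" "near E k u v"
        then obtain m where m: "m \<le> k" "(u, v) \<in> E ^^ m" by (auto simp: near_def)
        have "(u, v) \<in> H ^^ m"
          unfolding H_def using m(2)
        proof (rule relpow_restrict)
          fix z assume "near E m u z"
          then have "near E k u z" using m(1) by (rule near_mono)
          then show "z \<in> U" using near_lay[of k u z] near_V[of k u z] uv(1) by (auto simp: U_def)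
        qed
        then have "near H k u v" using m by (auto simp: near_def)
        moreover have "u \<in> U" "v \<in> U" using uv by (auto simp: U_def)
        ultimately show "(id u, id v) \<in> (steps H k {v \<in> U. c v = \<gamma>})\<^sup>*"
          using uv by (intro r_into_rtrancl) (simp add: steps_def)
      qed
      moreover have "x \<in> {v \<in> U. c v = \<gamma>}" using xy by (auto simp: U_def)
      ultimately have "near H F x y" using bounded_chainsD[OF c] by auto
      then show "near E F x y" by (rule near_mono_rel) (simp add: H_def)
    qed
  qed
qed

text \<open>Finds the run of three fine blocks containing block \<open>n\<close>. In the first part
  group \<open>b\<close> runs from \<open>4 * b - 2\<close> to \<open>4 * b + 1\<close>; excluding
  residues 0 and 1 leaves the end of the preceding run and forces \<open>b > 0\<close>.\<close>

lemma middle_blocks: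
  fixes n b :: nat
  shows "(n + 2) div 4 = b \<Longrightarrow> n mod 4 \<noteq> 0 \<Longrightarrow> n mod 4 \<noteq> 1 \<Longrightarrow>
      n div 4 = b - 1 \<and> 4 * (b - 1) + 1 \<le> n \<and> n < 4 * (b - 1) + 4"
    and "n div 4 = b \<Longrightarrow> n mod 4 \<noteq> 0 \<Longrightarrow> 4 * b + 1 \<le> n \<and> n < 4 * b + 4"
proof -
  define q r where "q = n div 4" and "r = n mod 4"
  have n: "n = 4 * q + r" "r < 4" by (simp_all add: q_def r_def)
  then have "r = 0 \<or> r = 1 \<or> (r = 2 \<or> r = 3) \<and> (n + 2) div 4 = Suc q" by auto
  then show "(n + 2) div 4 = b \<Longrightarrow> n mod 4 \<noteq> 0 \<Longrightarrow> n mod 4 \<noteq> 1 \<Longrightarrow>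
      n div 4 = b - 1 \<and> 4 * (b - 1) + 1 \<le> n \<and> n < 4 * (b - 1) + 4"
    using n unfolding q_def[symmetric] r_def[symmetric] by auto
  show "n div 4 = b \<Longrightarrow> n mod 4 \<noteq> 0 \<Longrightarrow> 4 * b + 1 \<le> n \<and> n < 4 * b + 4"
    using n unfolding q_def[symmetric] r_def[symmetric] by auto
qed

text \<open>\<open>(m + 2) div 4\<close> changes only from residue 1 to 2, and
  \<open>m div 4\<close> only from residue 3 to 0.\<close>

lemma div4_eq_of_close:
  fixes m n :: nat
  assumes "m \<le> Suc n" "n \<le> Suc m"
  shows "m mod 4 \<noteq> 1 \<Longrightarrow> n mod 4 \<noteq> 1 \<Longrightarrow> (m + 2) div 4 = (n + 2) div 4"
    and "m mod 4 \<noteq> 3 \<Longrightarrow> n mod 4 \<noteq> 3 \<Longrightarrow> m div 4 = n div 4"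
    and "odd m \<Longrightarrow> odd n \<Longrightarrow> m = n"
proof -
  have *: "m mod 4 \<noteq> 1 \<longrightarrow> (Suc m + 2) div 4 = (m + 2) div 4" "m mod 4 \<noteq> 3 \<longrightarrow> Suc m div 4 = m div 4"
    for m :: nat
  proof -
    define q r where "q = m div 4" and "r = m mod 4"
    have "m = 4 * q + r" "r = 0 \<or> r = 1 \<or> r = 2 \<or> r = 3" by (auto simp: q_def r_def)
    then show "m mod 4 \<noteq> 1 \<longrightarrow> (Suc m + 2) div 4 = (m + 2) div 4" "m mod 4 \<noteq> 3 \<longrightarrow> Suc m div 4 = m div 4"
      by auto
  qed
  have "m = n \<or> m = Suc n \<or> n = Suc m" using assms by linarith
  note cases = this *[of m] *[of n]
  show "m mod 4 \<noteq> 1 \<Longrightarrow> n mod 4 \<noteq> 1 \<Longrightarrow> (m + 2) div 4 = (n + 2) div 4"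
    using cases by metis
  show "m mod 4 \<noteq> 3 \<Longrightarrow> n mod 4 \<noteq> 3 \<Longrightarrow> m div 4 = n div 4"
    using cases by metis
  show "odd m \<Longrightarrow> odd n \<Longrightarrow> m = n"
    using cases(1) by auto
qed

text \<open>The layers are cut into blocks of \<open>k + 1\<close> layers. Blocks \<open>4 * j\<close> are coloured at a coarse
  scale, the blocks between them at a fine one. The third colour replaces the first one in
  blocks \<open>4 * j + 1\<close> and the second one in blocks \<open>4 * j + 3\<close>, so that a fine piece of the first or
  second colour meets only one of the two neighbouring coarse blocks.\<close>

theorem layered_order_colouring:
  "\<exists>F. \<forall>(V :: 'a set) E bk rk lay. layered_order V E bk rk lay w \<longrightarrow>
     (\<exists>c :: 'a \<Rightarrow> nat. range c \<subseteq> {1..3} \<and> (\<forall>i. bounded_chains E k F {v \<in> V. c v = i}))"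
proof -
  \<comment> \<open>A hop changes the layer by at most \<open>k\<close>, hence the block index by at
    most one.\<close>
  define g where "g = Suc k"
  have g0: "g > 0" by (simp add: g_def)
  obtain M where M: "\<forall>(V :: 'a set) E bk rk lay. layered_order V E bk rk lay w \<longrightarrow>
     (\<forall>a. \<exists>c :: 'a \<Rightarrow> bool. \<forall>\<gamma>. bounded_chains E k M {v \<in> V. a \<le> lay v \<and> lay v < a + 3 * g \<and> c v = \<gamma>})"
    using band_colouring[where w = w and k = k and n = "3 * g"] ..
  \<comment> \<open>The coarse scale is the one at which \<open>bounded_chains_Un\<close> absorbs
    fine pieces bounded by \<open>M\<close>.\<close>
  obtain D where D: "\<forall>(V :: 'a set) E bk rk lay. layered_order V E bk rk lay w \<longrightarrow>
     (\<forall>a. \<exists>c :: 'a \<Rightarrow> bool. \<forall>\<gamma>. bounded_chains E (2 * k + M) D {v \<in> V. a \<le> lay v \<and> lay v < a + g \<and> c v = \<gamma>})"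
    using band_colouring[where w = w and k = "2 * k + M" and n = g] ..
  show ?thesis
  proof (intro exI[of _ "D + 2 * k + 2 * M"] allI impI)
    fix V :: "'a set" and E bk rk lay
    assume L: "layered_order V E bk rk lay w"
    then interpret layered_order V E bk rk lay w .
    define \<beta> where "\<beta> v = lay v div g" for v
    have near_\<beta>: "\<beta> x \<le> Suc (\<beta> y)" "\<beta> y \<le> Suc (\<beta> x)" if "near E k x y" for x y
    proof -
      have "lay x \<le> lay y + g" "lay y \<le> lay x + g" using near_lay[OF that] by (auto simp: g_def)
      then have "lay x div g \<le> (lay y + g) div g" "lay y div g \<le> (lay x + g) div g"
        by (auto intro: div_le_mono)
      then show "\<beta> x \<le> Suc (\<beta> y)" "\<beta> y \<le> Suc (\<beta> x)" using g0 by (auto simp: \<beta>_def)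
    qed
    have \<beta>_range: "m \<le> \<beta> v \<longleftrightarrow> m * g \<le> lay v" "\<beta> v < m \<longleftrightarrow> lay v < m * g" for m v
      using g0 by (simp_all add: \<beta>_def less_eq_div_iff_mult_less_eq div_less_iff_less_mult)
    have "\<exists>c :: 'a \<Rightarrow> bool. \<forall>\<gamma>. bounded_chains E k M {v \<in> V. 4 * j + 1 \<le> \<beta> v \<and> \<beta> v < 4 * j + 4 \<and> c v = \<gamma>}" for j
      using M[rule_format, OF L, of "(4 * j + 1) * g"] unfolding \<beta>_range by (simp add: algebra_simps)
    then have "\<forall>j. \<exists>c :: 'a \<Rightarrow> bool. \<forall>\<gamma>. bounded_chains E k M {v \<in> V. 4 * j + 1 \<le> \<beta> v \<and> \<beta> v < 4 * j + 4 \<and> c v = \<gamma>}" ..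
    from choice[OF this] obtain cM :: "nat \<Rightarrow> 'a \<Rightarrow> bool" where
      cM: "\<And>j \<gamma>. bounded_chains E k M {v \<in> V. 4 * j + 1 \<le> \<beta> v \<and> \<beta> v < 4 * j + 4 \<and> cM j v = \<gamma>}" by blast
    have "\<exists>c :: 'a \<Rightarrow> bool. \<forall>\<gamma>. bounded_chains E (2 * k + M) D {v \<in> V. 4 * j \<le> \<beta> v \<and> \<beta> v < 4 * j + 1 \<and> c v = \<gamma>}" for j
      using D[rule_format, OF L, of "4 * j * g"] unfolding \<beta>_range by (simp add: algebra_simps)
    then have "\<forall>j. \<exists>c :: 'a \<Rightarrow> bool. \<forall>\<gamma>. bounded_chains E (2 * k + M) D {v \<in> V. 4 * j \<le> \<beta> v \<and> \<beta> v < 4 * j + 1 \<and> c v = \<gamma>}" ..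
    from choice[OF this] obtain cD :: "nat \<Rightarrow> 'a \<Rightarrow> bool" where
      cD: "\<And>j \<gamma>. bounded_chains E (2 * k + M) D {v \<in> V. 4 * j \<le> \<beta> v \<and> \<beta> v < 4 * j + 1 \<and> cD j v = \<gamma>}" by blast
    define c :: "'a \<Rightarrow> nat" where "c v =
      (if \<beta> v mod 4 = 0 then (if cD (\<beta> v div 4) v then 1 else 2)
       else if cM (\<beta> v div 4) v then (if \<beta> v mod 4 = 1 then 3 else 1)
       else (if \<beta> v mod 4 = 3 then 3 else 2))" for v
    \<comment> \<open>The third colour occurs in odd blocks only, and no hop joins two different odd
      blocks.\<close>
    have third: "bounded_chains E k (D + 2 * k + 2 * M) {v \<in> V. c v = 3}"
    proof (rule bounded_chains_classes[where h = \<beta>])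
      fix b
      show "bounded_chains E k (D + 2 * k + 2 * M) {v \<in> {v \<in> V. c v = 3}. \<beta> v = b}"
        by (rule bounded_chains_mono[OF cM[where j = "b div 4" and \<gamma> = "b mod 4 = 1"]])
          (auto simp: c_def split: if_splits, presburger+)
    next
      fix x y assume xy: "x \<in> {v \<in> V. c v = 3}" "y \<in> {v \<in> V. c v = 3}" "near E k x y"
      then have "\<beta> x mod 4 = 1 \<or> \<beta> x mod 4 = 3" "\<beta> y mod 4 = 1 \<or> \<beta> y mod 4 = 3"
        by (auto simp: c_def split: if_splits)
      moreover have "odd m" if "m mod 4 = 1 \<or> m mod 4 = 3" for m :: nat using that by presburger
      ultimately show "\<beta> x = \<beta> y" using div4_eq_of_close(3)[OF near_\<beta>[OF xy(3)]] by blast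
    qed
    \<comment> \<open>The shift \<open>s\<close> cuts the groups right after the blocks without
      colour \<open>i\<close>: residue 1 for \<open>i = 1\<close>, residue 3 for
      \<open>i = 2\<close>. A group contains one coarse block.\<close>
    have first_second: "bounded_chains E k (D + 2 * k + 2 * M) {v \<in> V. c v = i}"
      if i: "i = 1 \<and> s = 2 \<or> i = 2 \<and> s = 0" for i s :: nat
    proof (rule bounded_chains_classes[where h = "\<lambda>v. (\<beta> v + s) div 4"])
      fix b
      let ?S = "{v \<in> {v \<in> V. c v = i}. (\<beta> v + s) div 4 = b}"
      let ?A = "{v \<in> ?S. \<beta> v mod 4 = 0}" and ?C = "{v \<in> ?S. \<beta> v mod 4 \<noteq> 0}"
      have A: "bounded_chains E (2 * k + M) D ?A"
      proof (rule bounded_chains_mono[OF cD[where j = b and \<gamma> = "i = 1"]])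
        show "?A \<subseteq> {v \<in> V. 4 * b \<le> \<beta> v \<and> \<beta> v < 4 * b + 1 \<and> cD b v = (i = 1)}"
        proof
          fix v assume v: "v \<in> ?A"
          then have "\<beta> v div 4 = b \<and> \<beta> v = 4 * b" using i by auto
          then show "v \<in> {v \<in> V. 4 * b \<le> \<beta> v \<and> \<beta> v < 4 * b + 1 \<and> cD b v = (i = 1)}"
            using v i by (auto simp: c_def split: if_splits)
        qed
      qed auto
      have C: "bounded_chains E k M ?C"
      proof (rule bounded_chains_mono[OF cM[where j = "if i = 1 then b - 1 else b" and \<gamma> = "i = 1"]])
        show "?C \<subseteq> {v \<in> V. 4 * (if i = 1 then b - 1 else b) + 1 \<le> \<beta> v \<and> \<beta> v < 4 * (if i = 1 then b - 1 else b) + 4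
          \<and> cM (if i = 1 then b - 1 else b) v = (i = 1)}"
        proof
          fix v assume v: "v \<in> ?C"
          let ?j = "if i = 1 then b - 1 else b"
          have "\<beta> v mod 4 \<noteq> 0" "(\<beta> v + s) div 4 = b" "i = 1 \<longrightarrow> \<beta> v mod 4 \<noteq> 1"
            using v by (auto simp: c_def split: if_splits)
          then have "\<beta> v div 4 = ?j \<and> 4 * ?j + 1 \<le> \<beta> v \<and> \<beta> v < 4 * ?j + 4"
            using i middle_blocks(1)[of "\<beta> v" b] middle_blocks(2)[of "\<beta> v" b] by auto
          then show "v \<in> {v \<in> V. 4 * ?j + 1 \<le> \<beta> v \<and> \<beta> v < 4 * ?j + 4 \<and> cM ?j v = (i = 1)}"
            using v i by (auto simp: c_def split: if_splits)
        qed
      qed auto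
      have "?A \<union> ?C = ?S" by auto
      then show "bounded_chains E k (D + 2 * k + 2 * M) ?S"
        using bounded_chains_Un[OF sym_E C A] by simp
    next
      fix x y assume xy: "x \<in> {v \<in> V. c v = i}" "y \<in> {v \<in> V. c v = i}" "near E k x y"
      have "i = 1 \<longrightarrow> \<beta> v mod 4 \<noteq> 1" "i = 2 \<longrightarrow> \<beta> v mod 4 \<noteq> 3" if "c v = i" for v
        using that by (auto simp: c_def split: if_splits)
      then show "(\<beta> x + s) div 4 = (\<beta> y + s) div 4"
        using div4_eq_of_close[OF near_\<beta>[OF xy(3)]] xy i by auto
    qed
    have c_range: "c v \<in> {1..3}" for v by (auto simp: c_def)
    show "\<exists>c :: 'a \<Rightarrow> nat. range c \<subseteq> {1..3} \<and> (\<forall>i. bounded_chains E k (D + 2 * k + 2 * M) {v \<in> V. c v = i})"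
    proof (intro exI[of _ c] conjI allI)
      show "range c \<subseteq> {1..3}" using c_range by blast
      fix i :: nat
      consider "i = 1" | "i = 2" | "i = 3" | "i \<notin> {1..3}" by force
      then show "bounded_chains E k (D + 2 * k + 2 * M) {v \<in> V. c v = i}"
      proof cases
        case 4
        then have "{v \<in> V. c v = i} = {}" using c_range by blast
        then show ?thesis by (simp only: bounded_chains_def) simp
      qed (use third first_second[of 1 2] first_second[of 2 0] in simp_all)
    qed
  qed
qed

section \<open>Elimination orders from tree-decompositions\<close>

lemma relpow_distinct_path:
  assumes "(x, y) \<in> E ^^ n"
  shows "\<exists>p. p \<noteq> [] \<and> hd p = x \<and> last p = y \<and> distinct p \<and> successively (\<lambda>u v. (u, v) \<in> E) p \<and>
    length p \<le> Suc n \<and> set p \<subseteq> insert x (Range E)"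
  using assms
proof (induction n arbitrary: y)
  case 0
  then show ?case by (intro exI[of _ "[x]"]) auto
next
  case (Suc n)
  then obtain z where z: "(x, z) \<in> E ^^ n" "(z, y) \<in> E" by auto
  from Suc.IH[OF z(1)] obtain p where p: "p \<noteq> []" "hd p = x" "last p = z" "distinct p"
    "successively (\<lambda>u v. (u, v) \<in> E) p" "length p \<le> Suc n" "set p \<subseteq> insert x (Range E)" by blast
  show ?case
  proof (cases "y \<in> set p")
    case True
    then obtain p1 p2 where "p = p1 @ y # p2" by (meson split_list)
    then have "p = (p1 @ [y]) @ p2" by simp
    then show ?thesis using p
      by (intro exI[of _ "p1 @ [y]"]) (auto simp: successively_append_iff hd_append split: if_splits)
  next
    case False
    then show ?thesis using p z(2)
      by (intro exI[of _ "p @ [y]"]) (auto simp: successively_append_iff)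
  qed
qed

lemma successively_relpow:
  "p \<noteq> [] \<Longrightarrow> successively (\<lambda>u v. (u, v) \<in> E) p \<Longrightarrow> (hd p, last p) \<in> E ^^ (length p - 1)"
proof (induction p)
  case (Cons a p)
  show ?case
  proof (cases p)
    case Nil
    then show ?thesis by auto
  next
    case (Cons b q)
    then have "(a, b) \<in> E" "(b, last p) \<in> E ^^ (length p - 1)"
      using Cons.IH Cons.prems by auto
    then have "(a, last p) \<in> E ^^ Suc (length p - 1)" by (rule relpow_Suc_I2)
    then show ?thesis using Cons by auto
  qed
qed auto

section \<open>Rooted trees\<close>

locale rooted_tree =
  fixes T :: "'t sgraph" and r :: 't
  assumes tree: "is_tree T" and root: "r \<in> verts T"
begin

definition adj :: "'t rel" where
  "adj = {(s, t). {s, t} \<in> edges T}"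

lemma sym_adj: "sym adj"
  by (auto simp: adj_def sym_def insert_commute)

lemma adjD: "(s, t) \<in> adj \<Longrightarrow> s \<in> verts T \<and> t \<in> verts T \<and> s \<noteq> t"
  using tree by (auto simp: adj_def is_tree_def simple_graph_def)

definition depth :: "'t \<Rightarrow> nat" where
  "depth t = (LEAST n. (r, t) \<in> adj ^^ n)"

lemma depth_le: "(r, t) \<in> adj ^^ n \<Longrightarrow> depth t \<le> n"
  unfolding depth_def by (rule Least_le)

lemma depth_walk:
  assumes "t \<in> verts T"
  shows "(r, t) \<in> adj ^^ depth t"
proof -
  obtain p where "p \<in> paths_between T r t"
    using tree root assms unfolding is_tree_def connected_graph_def by blast
  then have "(r, t) \<in> adj ^^ (length p - 1)"
    using successively_relpow[of p adj] by (auto simp: paths_between_def is_path_def adj_def)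
  then show ?thesis unfolding depth_def by (rule LeastI)
qed

lemma depth_edge: "(s, t) \<in> adj \<Longrightarrow> depth t \<le> Suc (depth s)"
  using depth_walk adjD by (intro depth_le) (auto intro: relpow_Suc_I)

lemma lower_neighbour:
  assumes "t \<in> verts T" "depth t > 0"
  shows "\<exists>s. (s, t) \<in> adj \<and> depth s < depth t"
proof -
  obtain n where n: "depth t = Suc n" using assms by (cases "depth t") auto
  then obtain s where "(r, s) \<in> adj ^^ n" "(s, t) \<in> adj" using depth_walk[OF assms(1)] by auto
  then show ?thesis using depth_le[of s n] n by (intro exI[of _ s]) auto
qed

lemma depth_0: "t \<in> verts T \<Longrightarrow> depth t = 0 \<Longrightarrow> t = r"
  using depth_walk[of t] by auto

text \<open>Going to lower neighbours, every vertex after \<open>s\<close> has smaller depth than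
  \<open>t\<close>.\<close>

lemma reach_root_avoiding:
  assumes "s \<in> verts T" "s \<noteq> t" "depth s \<le> depth t"
  shows "(s, r) \<in> (adj \<inter> (- {t}) \<times> (- {t}))\<^sup>*"
  using assms
proof (induction "depth s" arbitrary: s rule: less_induct)
  case less
  show ?case
  proof (cases "depth s = 0")
    case True
    then show ?thesis using depth_0 less by auto
  next
    case False
    then obtain u where u: "(u, s) \<in> adj" "depth u < depth s" using lower_neighbour less by auto
    then have "u \<noteq> t" using less by auto
    then have "(u, r) \<in> (adj \<inter> (- {t}) \<times> (- {t}))\<^sup>*" using less u adjD by (intro less.hyps) auto
    moreover have "(s, u) \<in> adj \<inter> (- {t}) \<times> (- {t})"
      using u less \<open>u \<noteq> t\<close> sym_adj by (auto dest: symD)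
    ultimately show ?thesis by (rule converse_rtrancl_into_rtrancl[rotated])
  qed
qed

text \<open>Two such neighbours are joined through the root without passing \<open>t\<close>; a
  simple path between them closes through \<open>t\<close> to a cycle.\<close>

lemma unique_lower:
  assumes "(s, t) \<in> adj" "(s', t) \<in> adj" "depth s \<le> depth t" "depth s' \<le> depth t"
  shows "s = s'"
proof (rule ccontr)
  assume ne: "s \<noteq> s'"
  let ?R = "adj \<inter> (- {t}) \<times> (- {t})"
  have "sym ?R" using sym_adj by (auto simp: sym_def)
  then have "(s, s') \<in> ?R\<^sup>*"
    using reach_root_avoiding[of s t] reach_root_avoiding[of s' t] assms adjD
    by (meson rtrancl_trans sym_rtrancl symD)
  then obtain n where "(s, s') \<in> ?R ^^ n" using rtrancl_imp_relpow by blast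
  from relpow_distinct_path[OF this] obtain p where p: "p \<noteq> []" "hd p = s" "last p = s'" "distinct p"
    "successively (\<lambda>u v. (u, v) \<in> ?R) p" "set p \<subseteq> insert s (Range ?R)" by blast
  then obtain a b q where q: "p = a # b # q" using ne by (cases p; cases "tl p") auto
  have "successively (\<lambda>u v. {u, v} \<in> edges T) p"
    using p(5) by (rule successively_mono) (auto simp: adj_def)
  moreover have "t \<notin> set p" "set p \<subseteq> verts T" using p(6) adjD assms(1) by auto
  ultimately have "is_cycle T (t # p)"
    using p(1-4) assms(1,2) adjD[OF assms(1)] q
    by (auto simp: is_cycle_def is_path_def adj_def insert_commute)
  then show False using tree by (auto simp: is_tree_def)
qed

definition up :: "'t \<Rightarrow> 't" where
  "up t = (SOME s. (s, t) \<in> adj \<and> depth s < depth t)"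

lemma up_eq:
  assumes "(s, t) \<in> adj" "depth s < depth t"
  shows "up t = s" "depth t = Suc (depth s)"
proof -
  have "(up t, t) \<in> adj \<and> depth (up t) < depth t"
    unfolding up_def by (rule someI[of _ s]) (use assms in auto)
  then show "up t = s" using unique_lower assms by (meson less_imp_le)
  show "depth t = Suc (depth s)" using depth_edge[OF assms(1)] assms(2) by auto
qed

lemma adj_cases:
  assumes "(s, t) \<in> adj"
  obtains "up t = s" "depth t = Suc (depth s)" | "up s = t" "depth s = Suc (depth t)"
proof -
  have "depth s \<noteq> depth t"
  proof
    assume e: "depth s = depth t"
    have "depth t > 0" using depth_0 e adjD[OF assms] by (cases "depth t") auto
    then obtain u where u: "(u, t) \<in> adj" "depth u < depth t" using lower_neighbour adjD assms by blast
    then have "u = s" using unique_lower[OF u(1) assms] e by auto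
    then show False using u e by auto
  qed
  moreover have "(t, s) \<in> adj" using assms sym_adj by (auto dest: symD)
  ultimately show thesis using up_eq[OF assms] up_eq[of t s] that by (meson linorder_neqE_nat)
qed

text \<open>After a step away from the root, turning back would repeat \<open>x\<close>, the only
  lower neighbour of \<open>y\<close>.\<close>

lemma path_keeps_rising:
  assumes "successively (\<lambda>u v. (u, v) \<in> adj) (x # y # q)" "distinct (x # y # q)" "up y = x" "depth y = Suc (depth x)"
  shows "depth x < depth (last (y # q))"
  using assms
proof (induction q arbitrary: x y)
  case (Cons z q)
  then have "(y, z) \<in> adj" by auto
  then show ?case
  proof (cases rule: adj_cases)
    case 1
    then have "depth y < depth (last (z # q))" using Cons.prems by (intro Cons.IH) auto
    then show ?thesis using Cons.prems by auto
  next
    case 2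
    then show ?thesis using Cons.prems by auto
  qed
qed auto

text \<open>A path to its lowest vertex never steps away from the root, as it could not come
  back.\<close>

lemma path_to_lowest:
  assumes "successively (\<lambda>u v. (u, v) \<in> adj) p" "distinct p" "p \<noteq> []" "\<forall>t\<in>set p. depth (last p) \<le> depth t"
  shows "\<exists>n. (up ^^ n) (hd p) = last p \<and> (\<forall>m\<le>n. (up ^^ m) (hd p) \<in> set p \<and> depth ((up ^^ m) (hd p)) + m = depth (hd p))"
  using assms
proof (induction p)
  case (Cons a p)
  show ?case
  proof (cases p)
    case Nil
    then show ?thesis by (intro exI[of _ 0]) auto
  next
    case p: (Cons b q)
    then have "(a, b) \<in> adj" using Cons by auto
    then show ?thesis
    proof (cases rule: adj_cases)
      case 1
      then have "depth a < depth (last (b # q))" using Cons.prems p by (intro path_keeps_rising) auto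
      then show ?thesis using Cons.prems p by auto
    next
      case 2
      obtain n where n: "(up ^^ n) b = last p"
        "\<forall>m\<le>n. (up ^^ m) b \<in> set p \<and> depth ((up ^^ m) b) + m = depth b"
        using Cons p by auto
      show ?thesis
      proof (intro exI[of _ "Suc n"] conjI allI impI)
        show "(up ^^ Suc n) (hd (a # p)) = last (a # p)"
          using n(1) 2 p by (simp add: funpow_swap1)
        fix m assume m: "m \<le> Suc n"
        show "(up ^^ m) (hd (a # p)) \<in> set (a # p)" "depth ((up ^^ m) (hd (a # p))) + m = depth (hd (a # p))"
          using n(2) 2 m by (cases m; auto simp: funpow_swap1)+
      qed
    qed
  qed
qed auto

definition top :: "'t set \<Rightarrow> 't" where
  "top S = arg_min depth (\<lambda>t. t \<in> S)"

lemma top_in: "S \<noteq> {} \<Longrightarrow> top S \<in> S"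
  unfolding top_def by (metis arg_min_natI ex_in_conv)

lemma top_least: "t \<in> S \<Longrightarrow> depth (top S) \<le> depth t"
  unfolding top_def by (rule arg_min_nat_le)

lemma connected_up:
  assumes "connected_graph (induced_subgraph T S)" "t \<in> S"
  shows "top S = (up ^^ (depth t - depth (top S))) t"
    and "m \<le> depth t - depth (top S) \<Longrightarrow> (up ^^ m) t \<in> S \<and> depth ((up ^^ m) t) + m = depth t"
proof -
  have "paths_between (induced_subgraph T S) t (top S) \<noteq> {}"
    using assms top_in[of S] by (auto simp: connected_graph_def induced_subgraph_def)
  then obtain p where p: "is_path (induced_subgraph T S) p" "hd p = t" "last p = top S"
    by (auto simp: paths_between_def)
  have S: "set p \<subseteq> S" "p \<noteq> []" "distinct p" using p by (auto simp: is_path_def induced_subgraph_def)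
  have "successively (\<lambda>u v. (u, v) \<in> adj) p"
    using p(1) by (auto simp: is_path_def induced_subgraph_def adj_def elim: successively_mono)
  from path_to_lowest[OF this S(3,2)] obtain n where n: "(up ^^ n) t = top S"
    "\<forall>m\<le>n. (up ^^ m) t \<in> set p \<and> depth ((up ^^ m) t) + m = depth t"
    using p S top_least by auto
  then have "n = depth t - depth (top S)" by (metis diff_add_inverse order_refl)
  then show "top S = (up ^^ (depth t - depth (top S))) t"
    "m \<le> depth t - depth (top S) \<Longrightarrow> (up ^^ m) t \<in> S \<and> depth ((up ^^ m) t) + m = depth t"
    using n S by auto
qed

text \<open>Both tops are ancestors of \<open>t\<close>, and the deeper one is passed on the way up
  inside \<open>S\<close>.\<close>

lemma top_in_meeting_subtree:
  assumes "connected_graph (induced_subgraph T S)" "connected_graph (induced_subgraph T S')"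
    and "t \<in> S" "t \<in> S'" "depth (top S) \<le> depth (top S')"
  shows "top S' \<in> S"
  using connected_up(1)[OF assms(2,4)] connected_up(2)[OF assms(1,3), of "depth t - depth (top S')"] assms(5)
  by simp

end

text \<open>Vertices are ordered by the depth of the top of their subtree. Back neighbours of
  \<open>v\<close> are the earlier vertices in the bag at its top. Vertices sharing a bag are
  comparable, since the deeper top lies in both subtrees.\<close>

theorem tree_decomposition_elimination_order:
  assumes td: "tree_decomposition G T X" and fin: "finite (verts G)"
    and E: "sym E" "E \<subseteq> verts G \<times> verts G" "\<And>u v. (u, v) \<in> E \<Longrightarrow> {u, v} \<in> edges G"
  shows "\<exists>bk rk. elimination_order (verts G) E bk rk \<and> (\<forall>v\<in>verts G. \<exists>t\<in>verts T. insert v (bk v) \<subseteq> X t)"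
proof -
  have "is_tree T" using td by (simp add: tree_decomposition_def)
  then obtain r where "r \<in> verts T" by (auto simp: is_tree_def connected_graph_def)
  then interpret rooted_tree T r using \<open>is_tree T\<close> by unfold_locales
  define S where "S v = {t \<in> verts T. v \<in> X t}" for v
  have S: "connected_graph (induced_subgraph T (S v))" if "v \<in> verts G" for v
    using td that by (auto simp: tree_decomposition_def S_def)
  then have S_ne: "S v \<noteq> {}" if "v \<in> verts G" for v
    using that by (force simp: connected_graph_def induced_subgraph_def)
  obtain idx :: "'a \<Rightarrow> nat" and n where idx: "idx ` verts G = {i. i < n}" "inj_on idx (verts G)"
    using finite_imp_inj_to_nat_seg[OF fin] by metis
  define d where "d v = depth (top (S v))" for v
  \<comment> \<open>\<open>idx\<close> is below \<open>n\<close> on vertices, so depths are compared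
    first and \<open>idx\<close> breaks ties.\<close>
  define rk where "rk v = d v * n + idx v" for v
  define bk where "bk v = {u \<in> verts G. rk u < rk v \<and> top (S v) \<in> S u}" for v
  have idx_less: "idx v < n" if "v \<in> verts G" for v using idx(1) that by blast
  have d_rk: "d u = rk u div n" "idx u = rk u mod n" if "u \<in> verts G" for u
    using idx_less[OF that] by (auto simp: rk_def)
  have rk_d: "d u \<le> d v" if "rk u < rk v" "u \<in> verts G" "v \<in> verts G" for u v
    using that d_rk by (simp add: div_le_mono)
  have meet: "u \<in> bk v" if "rk u < rk v" "u \<in> verts G" "v \<in> verts G" "t \<in> S u" "t \<in> S v" for u v t
    using top_in_meeting_subtree[OF S S that(4,5)] that rk_d by (auto simp: bk_def d_def)
  have inj: "inj_on rk (verts G)"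
    using d_rk idx(2) by (metis inj_onD inj_onI)
  have "elimination_order (verts G) E bk rk"
  proof
    show "u \<in> bk u'" if "v \<in> verts G" "u \<in> bk v" "u' \<in> bk v" "rk u < rk u'" for v u u'
      using that meet[of u u' "top (S v)"] by (auto simp: bk_def)
    show "u = v \<or> u \<in> bk v \<or> v \<in> bk u" if e: "(u, v) \<in> E" for u v
    proof -
      have V: "u \<in> verts G" "v \<in> verts G" using E(2) e by auto
      obtain t where "t \<in> S u" "t \<in> S v"
        using td E(3)[OF e] by (fastforce simp: tree_decomposition_def S_def)
      then show ?thesis using meet V inj by (metis inj_onD linorder_neqE_nat)
    qed
  qed (use fin E inj in \<open>auto simp: bk_def\<close>)
  moreover have "top (S v) \<in> verts T \<and> insert v (bk v) \<subseteq> X (top (S v))" if "v \<in> verts G" for v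
    using top_in[OF S_ne[OF that]] by (auto simp: bk_def S_def)
  ultimately show ?thesis by blast
qed

section \<open>Weighted graphs\<close>

definition light_edges :: "'a wgraph \<Rightarrow> real \<Rightarrow> 'a rel" where
  "light_edges W r = {(u, v). {u, v} \<in> edges (fst W) \<and> snd W {u, v} \<le> r}"

lemma sym_light_edges: "sym (light_edges W r)"
  by (auto simp: light_edges_def sym_def insert_commute)

lemma light_edges_subset:
  assumes "weighted_graph W"
  shows "light_edges W r \<subseteq> verts (fst W) \<times> verts (fst W)"
  using assms by (auto simp: light_edges_def weighted_graph_def simple_graph_def split: prod.splits)

lemma is_path_edge:
  "is_path G p \<Longrightarrow> i < length p - 1 \<Longrightarrow> {p ! i, p ! Suc i} \<in> edges G"
  by (auto simp: is_path_def successively_conv_nth)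

text \<open>Finitely many paths exist, so the infimum is attained. On a path of length at most
  \<open>r\<close> every edge is light, and at most \<open>r / \<epsilon>\<close> edges fit.\<close>

lemma wdist_le_near:
  assumes W: "weighted_graph W" and fin: "finite (verts (fst W))"
    and \<epsilon>: "\<epsilon> > 0" "\<And>e. e \<in> edges (fst W) \<Longrightarrow> \<epsilon> \<le> snd W e"
    and d: "wdist W x y \<le> ereal r"
  shows "near (light_edges W r) (nat \<lfloor>r / \<epsilon>\<rfloor>) x y"
proof -
  obtain G \<phi> where GP: "W = (G, \<phi>)" by force
  let ?P = "paths_between G x y"
  have "?P \<subseteq> {p. set p \<subseteq> verts G \<and> length p \<le> card (verts G)}"
    using fin GP by (auto simp: paths_between_def is_path_def distinct_card[symmetric] intro: card_mono)
  then have fP: "finite ?P" using finite_lists_length_le[OF fin] GP by (auto intro: finite_subset)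
  have w: "wdist W x y = (INF p\<in>?P. ereal (path_length \<phi> p))" by (simp add: wdist_def GP)
  have "?P \<noteq> {}"
  proof
    assume "?P = {}"
    then have "wdist W x y = \<infinity>" by (simp add: w top_ereal_def)
    then show False using d by simp
  qed
  then have "wdist W x y \<in> (\<lambda>p. ereal (path_length \<phi> p)) ` ?P"
    unfolding w using fP by (intro finite_Inf_in) (auto simp: inf_min min_def)
  then obtain p where p: "p \<in> ?P" "path_length \<phi> p \<le> r" using d by auto
  have path: "is_path G p" using p by (auto simp: paths_between_def)
  have edge: "\<epsilon> \<le> \<phi> {p ! i, p ! Suc i}" if "i < length p - 1" for i
    using \<epsilon>(2) is_path_edge[OF path that] GP by auto
  have light: "\<phi> {p ! i, p ! Suc i} \<le> r" if "i < length p - 1" for i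
  proof -
    have "\<phi> {p ! i, p ! Suc i} \<le> path_length \<phi> p"
      unfolding path_length_def using that edge \<epsilon>(1)
      by (intro member_le_sum) (fastforce intro: order.trans[OF less_imp_le])+
    then show ?thesis using p by linarith
  qed
  have "(hd p, last p) \<in> light_edges W r ^^ (length p - 1)"
    using path light is_path_edge[OF path] GP
    by (intro successively_relpow) (auto simp: is_path_def successively_conv_nth light_edges_def)
  moreover have "real (length p - 1) * \<epsilon> \<le> path_length \<phi> p"
    unfolding path_length_def using sum_mono[of "{..<length p - 1}" "\<lambda>_. \<epsilon>"] edge by auto
  then have "real (length p - 1) \<le> r / \<epsilon>" using p \<epsilon> by (simp add: pos_le_divide_eq)
  then have "length p - 1 \<le> nat \<lfloor>r / \<epsilon>\<rfloor>" by (simp add: le_nat_floor)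
  ultimately show ?thesis using p(1) by (auto simp: near_def paths_between_def)
qed

text \<open>Shortening the walk to a simple path adds no edges, and each edge weighs at most
  \<open>r\<close>.\<close>

lemma near_wdist_le:
  assumes W: "weighted_graph W" and r: "r \<ge> 0" and x: "x \<in> verts (fst W)"
    and n: "near (light_edges W r) n x y"
  shows "wdist W x y \<le> ereal (real n * r)"
proof -
  obtain G \<phi> where GP: "W = (G, \<phi>)" by force
  obtain m where m: "m \<le> n" "(x, y) \<in> light_edges W r ^^ m" using n by (auto simp: near_def)
  from relpow_distinct_path[OF m(2)] obtain p where p: "p \<noteq> []" "hd p = x" "last p = y" "distinct p"
    "successively (\<lambda>u v. (u, v) \<in> light_edges W r) p" "length p \<le> Suc m" "set p \<subseteq> insert x (Range (light_edges W r))"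
    by blast
  have "set p \<subseteq> verts G" using p(7) x light_edges_subset[OF W] GP by fastforce
  moreover have "successively (\<lambda>u v. {u, v} \<in> edges G) p"
    using p(5) by (rule successively_mono) (auto simp: light_edges_def GP)
  ultimately have "p \<in> paths_between G x y"
    using p by (auto simp: paths_between_def is_path_def)
  then have "wdist W x y \<le> ereal (path_length \<phi> p)"
    by (simp add: wdist_def GP) (rule INF_lower)
  also have "path_length \<phi> p \<le> (\<Sum>i<length p - 1. r)"
    unfolding path_length_def using p(5)
    by (intro sum_mono) (auto simp: successively_conv_nth light_edges_def GP)
  also have "\<dots> = real (length p - 1) * r" by simp
  also have "\<dots> \<le> real n * r" using p(6) m(1) r by (intro mult_right_mono) auto
  finally show ?thesis by simp
qed

lemma chain_components:
  assumes "sym E" "bounded_chains E k D S"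
  shows "\<exists>\<C>. \<Union>\<C> = S \<and> (\<forall>A\<in>\<C>. \<forall>x\<in>A. \<forall>y\<in>A. near E D x y) \<and>
    (\<forall>A\<in>\<C>. \<forall>B\<in>\<C>. A \<noteq> B \<longrightarrow> (\<forall>x\<in>A. \<forall>y\<in>B. \<not> near E k x y))"
proof -
  define R where "R = (steps E k S)\<^sup>* \<inter> S \<times> S"
  have "sym ((steps E k S)\<^sup>*)"
    using near_sym[OF assms(1)] by (intro sym_rtrancl) (auto simp: steps_def sym_def)
  then have eq: "equiv S R"
    unfolding R_def by (auto intro!: equivI simp: refl_on_def sym_def trans_def intro: rtrancl_trans)
  have "\<Union>(S // R) = S" using eq by (rule Union_quotient)
  moreover have "near E D x y" if "A \<in> S // R" "x \<in> A" "y \<in> A" for A x y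
  proof -
    have "(x, y) \<in> R" using quotient_eq_iff[OF eq that(1,1)] that by auto
    then show ?thesis using bounded_chainsD[OF assms(2)] by (auto simp: R_def)
  qed
  moreover have "\<not> near E k x y" if "A \<in> S // R" "B \<in> S // R" "A \<noteq> B" "x \<in> A" "y \<in> B" for A B x y
  proof
    assume "near E k x y"
    moreover have "x \<in> S" "y \<in> S" using that eq by (auto dest: in_quotient_imp_subset)
    ultimately have "(x, y) \<in> R" by (auto simp: R_def steps_def)
    then show False using quotient_eq_iff[OF eq that(1,2,4,5)] that(3) by auto
  qed
  ultimately show ?thesis by (intro exI[of _ "S // R"]) simp
qed

lemma layered_treewidth_order:
  assumes W: "weighted_graph W" and fin: "finite (verts (fst W))" and tw: "layered_treewidth (fst W) \<le> enat w"
  shows "\<exists>bk rk lay. layered_order (verts (fst W)) (light_edges W r) bk rk lay w"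
proof -
  let ?G = "fst W" and ?E = "light_edges W r"
  let ?P = "\<lambda>w. \<exists>(T :: nat sgraph) X L. tree_decomposition ?G T X \<and> layering ?G L \<and>
     (\<forall>t\<in>verts T. \<forall>i. finite (X t \<inter> L i) \<and> card (X t \<inter> L i) \<le> w)"
  \<comment> \<open>A strict bound on the infimum yields an attained width, which is then at most
    \<open>w\<close>.\<close>
  have "layered_treewidth ?G < enat (Suc w)" using tw by (meson enat_ord_simps(2) lessI order_le_less_trans)
  then obtain w' where "enat w' < enat (Suc w)" and P: "?P w'"
    unfolding layered_treewidth_def Inf_less_iff by blast
  then have w': "w' < Suc w" by simp
  then obtain T :: "nat sgraph" and X L where td: "tree_decomposition ?G T X" and L: "layering ?G L"
    and wd: "\<forall>t\<in>verts T. \<forall>i. finite (X t \<inter> L i) \<and> card (X t \<inter> L i) \<le> w'" using P by blast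
  have E_edges: "{u, v} \<in> edges ?G" if "(u, v) \<in> ?E" for u v using that by (auto simp: light_edges_def)
  obtain bk rk where e: "elimination_order (verts ?G) ?E bk rk"
    and bags: "\<forall>v\<in>verts ?G. \<exists>t\<in>verts T. insert v (bk v) \<subseteq> X t"
    using tree_decomposition_elimination_order[OF td fin sym_light_edges light_edges_subset[OF W] E_edges] by blast
  interpret elimination_order "verts ?G" ?E bk rk by (rule e)
  define lay where "lay v = (THE i. v \<in> L i)" for v
  have lay_eq: "lay v = i" if "v \<in> L i" for v i
    unfolding lay_def using L that by (intro the_equality) (auto simp: layering_def disjoint_family_on_def)
  have lay_in: "v \<in> L (lay v)" if "v \<in> verts ?G" for v
  proof -
    have "v \<in> (\<Union>i. L i)" using L that by (simp add: layering_def)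
    then obtain i where "v \<in> L i" by blast
    then show ?thesis using lay_eq by simp
  qed
  have "layered_order (verts ?G) ?E bk rk lay w"
  proof
    show "lay u \<le> Suc (lay v)" if uv: "(u, v) \<in> ?E" for u v
    proof -
      obtain i where "{u, v} \<subseteq> L i \<union> L (Suc i)" using L E_edges[OF uv] by (auto simp: layering_def)
      then show ?thesis using lay_eq by fastforce
    qed
    show "card (insert v (bk v) \<inter> {u. lay u = i}) \<le> w" if v: "v \<in> verts ?G" for v i
    proof -
      obtain t where t: "t \<in> verts T" "insert v (bk v) \<subseteq> X t" using bags v by blast
      have "insert v (bk v) \<inter> {u. lay u = i} \<subseteq> X t \<inter> L i" using t lay_in bk_V[OF v] v by auto
      then have "card (insert v (bk v) \<inter> {u. lay u = i}) \<le> card (X t \<inter> L i)"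
        using wd t by (intro card_mono) auto
      also have "\<dots> \<le> w" using wd t w' by (meson less_Suc_eq_le order_trans)
      finally show ?thesis .
    qed
  qed
  then show ?thesis by blast
qed

theorem theorem5p3:
  fixes \<epsilon>\<^sub>0 :: real and w :: nat and \<F> :: "'a wgraph set"
  assumes "\<epsilon>\<^sub>0 > 0" and "w > 0"
    and "\<And>G \<phi>. (G, \<phi>) \<in> \<F> \<Longrightarrow> weighted_graph (G, \<phi>)"
    and "\<And>G \<phi>. (G, \<phi>) \<in> \<F> \<Longrightarrow> finite (verts G)"
    and "\<And>G \<phi> e. (G, \<phi>) \<in> \<F> \<Longrightarrow> e \<in> edges G \<Longrightarrow> \<phi> e \<ge> \<epsilon>\<^sub>0"
    and "\<And>G \<phi>. (G, \<phi>) \<in> \<F> \<Longrightarrow> layered_treewidth G \<le> enat w"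
  shows "asymptotic_dimension (generated_space ` \<F>) \<le> 2"
proof -
  have "\<exists>F. \<forall>(V :: 'a set) E bk rk lay. layered_order V E bk rk lay w \<longrightarrow>
     (\<exists>c :: 'a \<Rightarrow> nat. range c \<subseteq> {1..3} \<and> (\<forall>i. bounded_chains E k F {v \<in> V. c v = i}))" for k
    by (rule layered_order_colouring)
  then have "\<forall>k. \<exists>F. \<forall>(V :: 'a set) E bk rk lay. layered_order V E bk rk lay w \<longrightarrow>
     (\<exists>c :: 'a \<Rightarrow> nat. range c \<subseteq> {1..3} \<and> (\<forall>i. bounded_chains E k F {v \<in> V. c v = i}))" ..
  \<comment> \<open>\<open>F\<close> is chosen before any graph, which makes the control function
    common to the class.\<close>
  from choice[OF this] obtain F where F: "\<forall>k (V :: 'a set) E bk rk lay. layered_order V E bk rk lay w \<longrightarrow>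
     (\<exists>c :: 'a \<Rightarrow> nat. range c \<subseteq> {1..3} \<and> (\<forall>i. bounded_chains E k (F k) {v \<in> V. c v = i}))" ..
  define k where "k r = nat \<lfloor>r / \<epsilon>\<^sub>0\<rfloor>" for r
  \<comment> \<open>The summand 1 keeps \<open>f r\<close> positive when \<open>F (k r)\<close> is
    0.\<close>
  define f where "f r = real (F (k r)) * r + 1" for r
  have "common_control_function (generated_space ` \<F>) 2 f"
    unfolding common_control_function_def
  proof (intro conjI allI impI ballI)
    show "f r > 0" if "r > 0" for r using that by (simp add: f_def add_nonneg_pos)
    fix Xd assume "Xd \<in> generated_space ` \<F>"
    then obtain W where W: "W \<in> \<F>" "Xd = (verts (fst W), wdist W)" by (auto simp: generated_space_def)
    have wg: "weighted_graph W" and fin: "finite (verts (fst W))" and tw: "layered_treewidth (fst W) \<le> enat w"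
      and \<epsilon>: "\<And>e. e \<in> edges (fst W) \<Longrightarrow> \<epsilon>\<^sub>0 \<le> snd W e"
      using assms(3-6)[of "fst W" "snd W"] W(1) by auto
    let ?V = "verts (fst W)"
    have "\<exists>\<U> :: nat \<Rightarrow> 'a set set.
        (\<forall>i\<in>{1..2+1}. \<forall>A\<in>\<U> i. A \<subseteq> ?V) \<and>
        ?V = (\<Union>i\<in>{1..2+1}. \<Union>(\<U> i)) \<and>
        (\<forall>i\<in>{1..2+1}. \<forall>A\<in>\<U> i. \<forall>B\<in>\<U> i. A \<noteq> B \<longrightarrow> (\<forall>x\<in>A. \<forall>y\<in>B. wdist W x y > ereal r)) \<and>
        (\<forall>i\<in>{1..2+1}. \<forall>A\<in>\<U> i. \<forall>x\<in>A. \<forall>y\<in>A. wdist W x y \<le> ereal (f r))" if r: "r > 0" for r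
    proof -
      let ?E = "light_edges W r"
      obtain bk rk lay where lo: "layered_order ?V ?E bk rk lay w"
        using layered_treewidth_order[OF wg fin tw, of r] by (elim exE)
      obtain c :: "'a \<Rightarrow> nat" where c: "range c \<subseteq> {1..3}" "\<And>i. bounded_chains ?E (k r) (F (k r)) {v \<in> ?V. c v = i}"
        using F[rule_format, OF lo, of "k r"] by (elim exE conjE) blast
      have "\<exists>\<C>. \<Union>\<C> = {v \<in> ?V. c v = i} \<and> (\<forall>A\<in>\<C>. \<forall>x\<in>A. \<forall>y\<in>A. near ?E (F (k r)) x y) \<and>
        (\<forall>A\<in>\<C>. \<forall>B\<in>\<C>. A \<noteq> B \<longrightarrow> (\<forall>x\<in>A. \<forall>y\<in>B. \<not> near ?E (k r) x y))" for i
        by (rule chain_components[OF sym_light_edges c(2)])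
      then have "\<forall>i. \<exists>\<C>. \<Union>\<C> = {v \<in> ?V. c v = i} \<and> (\<forall>A\<in>\<C>. \<forall>x\<in>A. \<forall>y\<in>A. near ?E (F (k r)) x y) \<and>
        (\<forall>A\<in>\<C>. \<forall>B\<in>\<C>. A \<noteq> B \<longrightarrow> (\<forall>x\<in>A. \<forall>y\<in>B. \<not> near ?E (k r) x y))" ..
      from choice[OF this] obtain \<U> where \<U>: "\<forall>i. \<Union>(\<U> i) = {v \<in> ?V. c v = i} \<and>
        (\<forall>A\<in>\<U> i. \<forall>x\<in>A. \<forall>y\<in>A. near ?E (F (k r)) x y) \<and>
        (\<forall>A\<in>\<U> i. \<forall>B\<in>\<U> i. A \<noteq> B \<longrightarrow> (\<forall>x\<in>A. \<forall>y\<in>B. \<not> near ?E (k r) x y))" ..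
      have cover: "\<Union>(\<U> i) = {v \<in> ?V. c v = i}" for i using \<U> by simp
      have sub: "A \<subseteq> ?V" if "A \<in> \<U> i" for A i using cover[of i] that by blast
      show ?thesis
      proof (intro exI[of _ \<U>] conjI ballI impI)
        show "?V = (\<Union>i\<in>{1..2+1}. \<Union>(\<U> i))" unfolding cover using c(1) by auto
      next
        fix i A B x y assume "A \<in> \<U> i" "B \<in> \<U> i" "A \<noteq> B" "x \<in> A" "y \<in> B"
        then have "\<not> near ?E (k r) x y" using \<U> by simp
        then show "wdist W x y > ereal r"
          using wdist_le_near[OF wg fin assms(1) \<epsilon>] unfolding k_def by (meson not_le)
      next
        fix i A x y assume A: "A \<in> \<U> i" "x \<in> A" "y \<in> A"
        then have "wdist W x y \<le> ereal (real (F (k r)) * r)"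
          using near_wdist_le[OF wg less_imp_le[OF r]] \<U> sub[OF A(1)] by (meson subsetD)
        also have "\<dots> \<le> ereal (f r)" by (simp add: f_def)
        finally show "wdist W x y \<le> ereal (f r)" .
      qed (use sub in auto)
    qed
    then show "case Xd of (X, d) \<Rightarrow> \<forall>r>0. \<exists>\<U> :: nat \<Rightarrow> 'a set set.
        (\<forall>i\<in>{1..2+1}. \<forall>A\<in>\<U> i. A \<subseteq> X) \<and>
        X = (\<Union>i\<in>{1..2+1}. \<Union>(\<U> i)) \<and>
        (\<forall>i\<in>{1..2+1}. \<forall>A\<in>\<U> i. \<forall>B\<in>\<U> i. A \<noteq> B \<longrightarrow> (\<forall>x\<in>A. \<forall>y\<in>B. d x y > ereal r)) \<and>
        (\<forall>i\<in>{1..2+1}. \<forall>A\<in>\<U> i. \<forall>x\<in>A. \<forall>y\<in>A. d x y \<le> ereal (f r))"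
      unfolding W(2) by auto
  qed
  then have "asymptotic_dimension (generated_space ` \<F>) \<le> enat 2"
    unfolding asymptotic_dimension_def by (intro Inf_lower) blast
  then show ?thesis by (simp add: numeral_eq_enat)
qed

end
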